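(* Let $W$ be the $2|1$-dimensional complex $\mathbb Z_2$-graded vector space with basis $w_1$ (odd), $w_2,w_3$ (even). (a) The cohomology of the codifferential $d=\psi^{0,1,1}_1$ has bases $$H^1=\langle\psi^{0,0,1}_1,\ \psi^{0,1,0}_1,\ \varphi^{1,0,0}_1+\varphi^{0,0,1}_3,\ \varphi^{1,0,0}_1+\varphi^{0,1,0}_2\rangle,$$ $$H^n=\langle\varphi^{1,0,n-1}_1+\varphi^{0,0,n}_3,\ \varphi^{1,n-1,0}_1+\varphi^{0,n,0}_2\rangle,\qquad n>1.$$ (b) The cohomology of the codifferential $d=\psi^{0,2,0}_1$ has bases $$H^1=\langle\psi^{0,0,1}_1,\ \psi^{0,1,0}_1,\ \varphi^{0,0,1}_3,\ \varphi^{0,1,0}_3,\ 2\varphi^{1,0,0}_1+\varphi^{0,1,0}_2\rangle,$$ $$H^n=\langle\psi^{0,0,n}_1,\ \varphi^{0,0,n}_3,\ \varphi^{0,1,n-1}_3,\ 2\varphi^{1,0,n-1}_1+\varphi^{0,1,n-1}_2\rangle,\qquad n>1.$$ (In each case the listed elements are cocycles whose classes form a basis.)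
   Context: All spaces are $\mathbb Z_2$-graded over $\mathbb C$. $S(W)=\bigoplus_{n\ge1}S^n(W)$ is the symmetric coalgebra of $W$ (so $w_1^2=0$). $L_n=\mathrm{Hom}(S^n(W),W)$ for $n\ge1$, $L_0=0$, and $L=\prod_{n\ge1}L_n$ is identified with the coderivations of $S(W)$; it is a $\mathbb Z_2$-graded Lie algebra under the graded commutator $[\cdot,\cdot]$. For a multi-index $I=(i_1,i_2,i_3)$ with $i_1\in\{0,1\}$, $i_2,i_3\ge0$, put $w_I=w_1^{i_1}w_2^{i_2}w_3^{i_3}$, $I!=i_1!i_2!i_3!$, and let $\varphi^I_j\in\mathrm{Hom}(S^{|I|}(W),W)$ be given by $\varphi^I_j(w_J)=I!\,\delta^I_J\,w_j$; when this element is odd it is written $\psi^I_j$. For a codifferential $d\in L_2$ (odd, $[d,d]=0$) let $D(\varphi)=[\varphi,d]$, which maps $L_n$ to $L_{n+1}$ and satisfies $D^2=0$; $H^n=\ker(D:L_n\to L_{n+1})/D(L_{n-1})$ for $n\ge1$. *)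

theory Defs
  imports
    "HOL-Analysis.Analysis"
    "HOL-Library.Poly_Mapping"
    "HOL-Library.Function_Algebras"
    "Jordan_Normal_Form.VS_Connect"
begin

(* "$" is component selection in complex ^ 3 below, not in the matrix library's vectors. *)
no_notation vec_index (infixl "$" 100)

section \<open>Free complex vector spaces\<close>

definition sscale :: "complex \<Rightarrow> ('a \<Rightarrow>\<^sub>0 complex) \<Rightarrow> ('a \<Rightarrow>\<^sub>0 complex)" (infixr "\<cdot>\<^sub>S" 75)
  where "c \<cdot>\<^sub>S x = Poly_Mapping.map (\<lambda>z. c * z) x"

lemma lookup_sscale [simp]: "Poly_Mapping.lookup (c \<cdot>\<^sub>S x) k = c * Poly_Mapping.lookup x k"
  by (simp add: sscale_def Poly_Mapping.map.rep_eq when_def)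

interpretation S: vector_space "sscale :: complex \<Rightarrow> ('a \<Rightarrow>\<^sub>0 complex) \<Rightarrow> _"
  by unfold_locales (auto intro!: poly_mapping_eqI simp: lookup_add algebra_simps)

abbreviation linear_S :: "(('a \<Rightarrow>\<^sub>0 complex) \<Rightarrow> ('b \<Rightarrow>\<^sub>0 complex)) \<Rightarrow> bool"
  where "linear_S \<equiv> Vector_Spaces.linear (\<cdot>\<^sub>S) (\<cdot>\<^sub>S)"

definition linext :: "('a \<Rightarrow> ('b \<Rightarrow>\<^sub>0 complex)) \<Rightarrow> ('a \<Rightarrow>\<^sub>0 complex) \<Rightarrow> ('b \<Rightarrow>\<^sub>0 complex)"
  where "linext f x = (\<Sum>k\<in>Poly_Mapping.keys x. Poly_Mapping.lookup x k \<cdot>\<^sub>S f k)"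

section \<open>The symmetric coalgebra of $W$\<close>

type_synonym mindex = "nat \<times> nat \<times> nat"

text \<open>The multi-indices $I$ for which $w_I$ is a basis element of
  $S(W) = \bigoplus_{n\ge1} S^n(W)$. The basis vector $w_j$ of $W$ is \<open>axis j 1\<close>.\<close>

typedef midx = "{I :: mindex. fst I \<le> 1 \<and> I \<noteq> (0, 0, 0)}"
  by (rule exI[of _ "(1, 0, 0)"]) simp

type_synonym SW = "midx \<Rightarrow>\<^sub>0 complex"
type_synonym SW2 = "midx \<times> midx \<Rightarrow>\<^sub>0 complex"
type_synonym W = "complex ^ 3"

fun mdeg :: "mindex \<Rightarrow> nat"
  where "mdeg (i1, i2, i3) = i1 + i2 + i3"

fun mfact :: "mindex \<Rightarrow> nat"
  where "mfact (i1, i2, i3) = fact i1 * fact i2 * fact i3"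

fun mbinom :: "mindex \<Rightarrow> mindex \<Rightarrow> nat"
  where "mbinom (k1, k2, k3) (i1, i2, i3) = (k1 choose i1) * (k2 choose i2) * (k3 choose i3)"

fun below :: "mindex \<Rightarrow> mindex set"
  where "below (k1, k2, k3) = {..k1} \<times> {..k2} \<times> {..k3}"

text \<open>The monomial $w_I$. It is $0$ if $i_1 \ge 2$, because $w_1^2 = 0$. It is also $0$ for
  $I = (0,0,0)$, because $S(W)$ has no component of degree $0$; this lets the sums below run over
  all multi-indices without listing the excluded extreme terms.\<close>

definition w :: "mindex \<Rightarrow> SW"
  where "w I = (if fst I \<le> 1 \<and> I \<noteq> (0, 0, 0) then Poly_Mapping.single (Abs_midx I) 1 else 0)"

definition coeff_S :: "SW \<Rightarrow> mindex \<Rightarrow> complex"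
  where "coeff_S x I =
    (if fst I \<le> 1 \<and> I \<noteq> (0, 0, 0) then Poly_Mapping.lookup x (Abs_midx I) else 0)"

definition S_deg :: "nat \<Rightarrow> SW set"
  where "S_deg n = {x. \<forall>K\<in>Poly_Mapping.keys x. mdeg (Rep_midx K) = n}"

definition par :: "midx \<Rightarrow> nat"
  where "par K = fst (Rep_midx K)"

definition par_W :: "3 \<Rightarrow> nat"
  where "par_W j = (if j = 1 then 1 else 0)"

definition unit_idx :: "3 \<Rightarrow> mindex"
  where "unit_idx j = (if j = 1 then (1, 0, 0) else if j = 2 then (0, 1, 0) else (0, 0, 1))"

definition S_part :: "nat \<Rightarrow> SW \<Rightarrow> SW"
  where "S_part p = linext (\<lambda>K. if par K = p then Poly_Mapping.single K 1 else 0)"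

definition tensor :: "SW \<Rightarrow> SW \<Rightarrow> SW2" (infixr "\<otimes>\<^sub>S" 70)
  where "x \<otimes>\<^sub>S y = linext (\<lambda>I. linext (\<lambda>J. Poly_Mapping.single (I, J) 1) y) x"

text \<open>The unshuffle comultiplication
  $\Delta(v_1 \cdots v_n) = \sum_{k=1}^{n-1} \sum_{\sigma \in Sh(k,n-k)} \epsilon(\sigma)\,
   v_{\sigma(1)} \cdots v_{\sigma(k)} \otimes v_{\sigma(k+1)} \cdots v_{\sigma(n)}$,
  evaluated on $w_K$. All Koszul signs are $+1$, as $w_K$ has at most one odd factor.\<close>

definition comult :: "SW \<Rightarrow> SW2"
  where "comult = linext (\<lambda>K. \<Sum>A\<in>below (Rep_midx K).
    of_nat (mbinom (Rep_midx K) A) \<cdot>\<^sub>S (w A \<otimes>\<^sub>S w (Rep_midx K - A)))"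

section \<open>Coderivations\<close>

text \<open>The component of parity $p$ of an endomorphism of $S(W)$.\<close>

definition parity_part :: "nat \<Rightarrow> (SW \<Rightarrow> SW) \<Rightarrow> (SW \<Rightarrow> SW)"
  where "parity_part p \<delta> x = (\<Sum>q\<in>{0, 1}. S_part ((p + q) mod 2) (\<delta> (S_part q x)))"

text \<open>$\delta \otimes 1$ and, for $\delta$ of parity $p$, $1 \otimes \delta$ with its Koszul sign:
  $(1 \otimes \delta)(x \otimes y) = (-1)^{p|x|}\, x \otimes \delta(y)$.\<close>

definition tensor_left :: "(SW \<Rightarrow> SW) \<Rightarrow> SW2 \<Rightarrow> SW2"
  where "tensor_left \<delta> =
    linext (\<lambda>(A, B). \<delta> (Poly_Mapping.single A 1) \<otimes>\<^sub>S Poly_Mapping.single B 1)"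

definition tensor_right :: "nat \<Rightarrow> (SW \<Rightarrow> SW) \<Rightarrow> SW2 \<Rightarrow> SW2"
  where "tensor_right p \<delta> =
    linext (\<lambda>(A, B). (- 1) ^ (p * par A) \<cdot>\<^sub>S
      (Poly_Mapping.single A 1 \<otimes>\<^sub>S \<delta> (Poly_Mapping.single B 1)))"

definition coderivation :: "(SW \<Rightarrow> SW) \<Rightarrow> bool"
  where "coderivation \<delta> \<longleftrightarrow> linear_S \<delta> \<and>
    (\<forall>p\<in>{0, 1}. \<forall>x. comult (parity_part p \<delta> x) =
      tensor_left (parity_part p \<delta>) (comult x) + tensor_right p (parity_part p \<delta>) (comult x))"

definition corestrict :: "(SW \<Rightarrow> SW) \<Rightarrow> (SW \<Rightarrow> W)"
  where "corestrict \<delta> x = (\<chi> j. coeff_S (\<delta> x) (unit_idx j))"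

text \<open>The identification of $L = \prod_{n\ge1} \mathrm{Hom}(S^n(W), W) = \mathrm{Hom}(S(W), W)$ with
  the coderivations of $S(W)$. Existence and uniqueness are proved in \<open>coder_unique\<close> below.\<close>

definition coder :: "(SW \<Rightarrow> W) \<Rightarrow> (SW \<Rightarrow> SW)"
  where "coder \<phi> = (THE \<delta>. coderivation \<delta> \<and> corestrict \<delta> = \<phi>)"

definition graded_commutator :: "(SW \<Rightarrow> SW) \<Rightarrow> (SW \<Rightarrow> SW) \<Rightarrow> (SW \<Rightarrow> SW)"
  where "graded_commutator \<alpha> \<beta> = (\<Sum>p\<in>{0, 1}. \<Sum>q\<in>{0, 1}.
    (\<lambda>x. parity_part p \<alpha> (parity_part q \<beta> x) - (- 1) ^ (p * q) \<cdot>\<^sub>S parity_part q \<beta> (parity_part p \<alpha> x)))"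

section \<open>The graded Lie algebra $L$ and cohomology\<close>

definition Hom_SW :: "(SW \<Rightarrow> W) set"
  where "Hom_SW = {\<phi>. Vector_Spaces.linear (\<cdot>\<^sub>S) (*s) \<phi>}"

text \<open>$L_n = \mathrm{Hom}(S^n(W), W)$, its elements being extended by $0$ to $S(W)$; $L_0 = 0$.\<close>

definition L :: "nat \<Rightarrow> (SW \<Rightarrow> W) set"
  where "L n = {\<phi>\<in>Hom_SW. \<forall>m. m \<noteq> n \<longrightarrow> (\<forall>x\<in>S_deg m. \<phi> x = 0)}"

definition has_parity :: "nat \<Rightarrow> (SW \<Rightarrow> W) \<Rightarrow> bool"
  where "has_parity p \<phi> \<longleftrightarrow>
    (\<forall>K j. \<phi> (Poly_Mapping.single K 1) $ j \<noteq> 0 \<longrightarrow> par_W j = (p + par K) mod 2)"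

definition bracket :: "(SW \<Rightarrow> W) \<Rightarrow> (SW \<Rightarrow> W) \<Rightarrow> (SW \<Rightarrow> W)"
  where "bracket \<phi> \<psi> = corestrict (graded_commutator (coder \<phi>) (coder \<psi>))"

text \<open>$\varphi^I_j$; the letter $\psi$ only records that the map is odd.\<close>

definition phi :: "mindex \<Rightarrow> 3 \<Rightarrow> (SW \<Rightarrow> W)"
  where "phi I j x = (of_nat (mfact I) * coeff_S x I) *s axis j 1"

abbreviation (input) psi :: "mindex \<Rightarrow> 3 \<Rightarrow> (SW \<Rightarrow> W)"
  where "psi \<equiv> phi"

definition hscale :: "complex \<Rightarrow> (SW \<Rightarrow> W) \<Rightarrow> (SW \<Rightarrow> W)" (infixr "\<cdot>\<^sub>H" 75)
  where "c \<cdot>\<^sub>H \<phi> = (\<lambda>x. c *s \<phi> x)"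

definition codifferential :: "(SW \<Rightarrow> W) \<Rightarrow> bool"
  where "codifferential d \<longleftrightarrow> d \<in> L 2 \<and> has_parity 1 d \<and> bracket d d = 0"

definition cocycles :: "(SW \<Rightarrow> W) \<Rightarrow> nat \<Rightarrow> (SW \<Rightarrow> W) set"
  where "cocycles d n = {\<phi>\<in>L n. bracket \<phi> d = 0}"

definition coboundaries :: "(SW \<Rightarrow> W) \<Rightarrow> nat \<Rightarrow> (SW \<Rightarrow> W) set"
  where "coboundaries d n = (\<lambda>\<phi>. bracket \<phi> d) ` L (n - 1)"

definition coh_class :: "(SW \<Rightarrow> W) \<Rightarrow> nat \<Rightarrow> (SW \<Rightarrow> W) \<Rightarrow> (SW \<Rightarrow> W) set"
  where "coh_class d n \<phi> = {\<phi> + \<beta> | \<beta>. \<beta> \<in> coboundaries d n}"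

text \<open>$H^n$ for $n \ge 1$ as a quotient vector space. The fields \<open>mult\<close> and \<open>one\<close> of the library's
  module record play no role in a module. Adding the coboundaries in \<open>smult\<close> only matters for
  the scalar $0$.\<close>

definition H :: "(SW \<Rightarrow> W) \<Rightarrow> nat \<Rightarrow> (complex, (SW \<Rightarrow> W) set) module"
  where "H d n = \<lparr>
    carrier = coh_class d n ` cocycles d n,
    mult = undefined,
    one = undefined,
    zero = coh_class d n 0,
    add = (\<lambda>X Y. {\<phi> + \<psi> | \<phi> \<psi>. \<phi> \<in> X \<and> \<psi> \<in> Y}),
    smult = (\<lambda>c X. {c \<cdot>\<^sub>H \<phi> + \<beta> | \<phi> \<beta>. \<phi> \<in> X \<and> \<beta> \<in> coboundaries d n})\<rparr>"

text \<open>The library's \<open>basis\<close> is a predicate on sets of vectors; distinctness of the listed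
  classes is therefore required separately.\<close>

definition cohomology_basis :: "(SW \<Rightarrow> W) \<Rightarrow> nat \<Rightarrow> (SW \<Rightarrow> W) list \<Rightarrow> bool"
  where "cohomology_basis d n zs \<longleftrightarrow>
    set zs \<subseteq> cocycles d n \<and>
    vectorspace class_ring (H d n) \<and>
    distinct (map (coh_class d n) zs) \<and>
    vectorspace.basis class_ring (H d n) (set (map (coh_class d n) zs))"

lemma phi_w:
  assumes "fst I \<le> 1" "I \<noteq> (0, 0, 0)"
  shows "phi I j (w J) = (if I = J then of_nat (mfact I) *s axis j 1 else 0)"
  using assms by (auto simp: phi_def coeff_S_def w_def lookup_single when_def Abs_midx_inject)

section \<open>Coderivations are determined by their corestriction\<close>

lemma linext_superset:
  assumes "finite A" "Poly_Mapping.keys x \<subseteq> A"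
  shows "linext f x = (\<Sum>k\<in>A. Poly_Mapping.lookup x k \<cdot>\<^sub>S f k)"
  unfolding linext_def using assms
  by (intro sum.mono_neutral_left) (auto simp: in_keys_iff)

lemma linear_linext: "linear_S (linext f)"
  unfolding Vector_Spaces.linear_iff
proof (intro conjI allI)
  show "vector_space ((\<cdot>\<^sub>S) :: complex \<Rightarrow> ('a \<Rightarrow>\<^sub>0 complex) \<Rightarrow> _)" by (rule S.vector_space_axioms)
  show "vector_space ((\<cdot>\<^sub>S) :: complex \<Rightarrow> ('b \<Rightarrow>\<^sub>0 complex) \<Rightarrow> _)" by (rule S.vector_space_axioms)
next
  fix x y :: "'a \<Rightarrow>\<^sub>0 complex"
  let ?A = "Poly_Mapping.keys x \<union> Poly_Mapping.keys y"
  have "Poly_Mapping.keys (x + y) \<subseteq> ?A" by (rule keys_add)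
  then show "linext f (x + y) = linext f x + linext f y"
    by (simp add: linext_superset[of ?A] lookup_add S.scale_left_distrib sum.distrib)
next
  fix c and x :: "'a \<Rightarrow>\<^sub>0 complex"
  have "Poly_Mapping.keys (c \<cdot>\<^sub>S x) \<subseteq> Poly_Mapping.keys x" by (auto simp: in_keys_iff)
  then show "linext f (c \<cdot>\<^sub>S x) = c \<cdot>\<^sub>S linext f x"
    by (simp add: linext_superset[of "Poly_Mapping.keys x"] S.scale_sum_right)
qed

lemma linext_single [simp]: "linext f (Poly_Mapping.single k c) = c \<cdot>\<^sub>S f k"
  by (simp add: linext_def)

lemma single_expansion: "x = linext (\<lambda>k. Poly_Mapping.single k 1) x"
proof (rule poly_mapping_eqI)
  fix k
  have "Poly_Mapping.lookup (linext (\<lambda>k. Poly_Mapping.single k 1) x) k =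
      (\<Sum>j\<in>Poly_Mapping.keys x. if j = k then Poly_Mapping.lookup x j else 0)"
    unfolding linext_def lookup_sum by (intro sum.cong) (auto simp: lookup_single when_def)
  then show "Poly_Mapping.lookup x k = Poly_Mapping.lookup (linext (\<lambda>k. Poly_Mapping.single k 1) x) k"
    by (simp add: in_keys_iff)
qed

lemma linear_S_eqI:
  assumes "Vector_Spaces.linear (\<cdot>\<^sub>S) s f" "Vector_Spaces.linear (\<cdot>\<^sub>S) s g"
    and eq: "\<And>k. f (Poly_Mapping.single k 1) = g (Poly_Mapping.single k 1)"
  shows "f = g"
proof
  fix x
  interpret f: Vector_Spaces.linear "(\<cdot>\<^sub>S)" s f by fact
  interpret g: Vector_Spaces.linear "(\<cdot>\<^sub>S)" s g by fact
  have "f (linext (\<lambda>k. Poly_Mapping.single k 1) x) = g (linext (\<lambda>k. Poly_Mapping.single k 1) x)"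
    unfolding linext_def f.sum g.sum f.scale g.scale eq ..
  then show "f x = g x" by (simp only: single_expansion[symmetric])
qed


lemma Rep_midx_prop: "fst (Rep_midx K) \<le> 1" "Rep_midx K \<noteq> (0, 0, 0)"
  using Rep_midx[of K] by auto

lemma w_Rep [simp]: "w (Rep_midx K) = Poly_Mapping.single K 1"
  using Rep_midx_prop[of K] by (simp add: w_def Rep_midx_inverse)

lemma w_zero [simp]: "w (0, 0, 0) = 0"
  by (simp add: w_def)

lemma w_cases:
  obtains "w I = 0" "\<not> (fst I \<le> 1 \<and> I \<noteq> (0, 0, 0))" | K where "I = Rep_midx K"
proof (cases "fst I \<le> 1 \<and> I \<noteq> (0, 0, 0)")
  case True
  then have "I = Rep_midx (Abs_midx I)" by (simp add: Abs_midx_inverse)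
  then show ?thesis by (rule that(2))
qed (rule that(1), auto simp: w_def)

lemma coeff_S_w: "coeff_S (w J) I = (if I = J \<and> fst I \<le> 1 \<and> I \<noteq> (0, 0, 0) then 1 else 0)"
  by (auto simp: coeff_S_def w_def lookup_single when_def Abs_midx_inject)

lemma coeff_S_add [simp]: "coeff_S (x + y) I = coeff_S x I + coeff_S y I"
  by (simp add: coeff_S_def lookup_add)

lemma coeff_S_scale [simp]: "coeff_S (c \<cdot>\<^sub>S x) I = c * coeff_S x I"
  by (simp add: coeff_S_def)

lemma coeff_S_zero [simp]: "coeff_S 0 I = 0"
  by (simp add: coeff_S_def)

lemma coeff_S_sum: "coeff_S (sum f A) I = (\<Sum>a\<in>A. coeff_S (f a) I)"
  by (induction A rule: infinite_finite_induct) auto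

lemma lookup_linext:
  "Poly_Mapping.lookup (linext f x) k =
    (\<Sum>j\<in>Poly_Mapping.keys x. Poly_Mapping.lookup x j * Poly_Mapping.lookup (f j) k)"
  by (simp add: linext_def lookup_sum)

lemma lookup_tensor [simp]:
  "Poly_Mapping.lookup (x \<otimes>\<^sub>S y) (I, J) = Poly_Mapping.lookup x I * Poly_Mapping.lookup y J"
proof -
  have 1: "Poly_Mapping.lookup (linext (\<lambda>J'. Poly_Mapping.single (I', J') 1) y) (I, J) =
      (if I' = I then Poly_Mapping.lookup y J else 0)" for I'
  proof -
    have "Poly_Mapping.lookup (linext (\<lambda>J'. Poly_Mapping.single (I', J') 1) y) (I, J) =
        (\<Sum>J'\<in>Poly_Mapping.keys y. if J' = J then (if I' = I then Poly_Mapping.lookup y J else 0) else 0)"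
      unfolding lookup_linext by (intro sum.cong) (auto simp: lookup_single when_def)
    then show ?thesis by (auto simp: in_keys_iff)
  qed
  have "Poly_Mapping.lookup (x \<otimes>\<^sub>S y) (I, J) =
      (\<Sum>I'\<in>Poly_Mapping.keys x. if I' = I then Poly_Mapping.lookup x I * Poly_Mapping.lookup y J else 0)"
    unfolding tensor_def by (subst lookup_linext, intro sum.cong refl) (simp add: 1)
  then show ?thesis by (auto simp: in_keys_iff)
qed

lemma tensor_add_left: "(x + y) \<otimes>\<^sub>S z = x \<otimes>\<^sub>S z + y \<otimes>\<^sub>S z"
  and tensor_add_right: "z \<otimes>\<^sub>S (x + y) = z \<otimes>\<^sub>S x + z \<otimes>\<^sub>S y"
  and tensor_scale_left: "(c \<cdot>\<^sub>S x) \<otimes>\<^sub>S z = c \<cdot>\<^sub>S (x \<otimes>\<^sub>S z)"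
  and tensor_scale_right: "z \<otimes>\<^sub>S (c \<cdot>\<^sub>S x) = c \<cdot>\<^sub>S (z \<otimes>\<^sub>S x)"
  and tensor_zero_left [simp]: "0 \<otimes>\<^sub>S z = 0"
  and tensor_zero_right [simp]: "z \<otimes>\<^sub>S 0 = 0"
  and tensor_sum_left: "sum f A \<otimes>\<^sub>S z = (\<Sum>a\<in>A. f a \<otimes>\<^sub>S z)"
  and tensor_sum_right: "z \<otimes>\<^sub>S sum f A = (\<Sum>a\<in>A. z \<otimes>\<^sub>S f a)"
  by (rule poly_mapping_eqI, clarify,
      simp add: lookup_add lookup_sum algebra_simps sum_distrib_left)+

lemma tensor_single [simp]:
  "Poly_Mapping.single A 1 \<otimes>\<^sub>S Poly_Mapping.single B 1 = Poly_Mapping.single (A, B) 1"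
  by (simp add: tensor_def)

lemma below_sum:
  "(\<Sum>A\<in>below (k1, k2, k3). f A) = (\<Sum>a\<le>k1. \<Sum>b\<le>k2. \<Sum>c\<le>k3. f (a, b, c))"
  by (simp add: sum.cartesian_product)

lemma finite_below [simp]: "finite (below K)"
  by (cases K) simp

declare below.simps [simp del]

lemma comult_w:
  assumes "fst K \<le> 1"
  shows "comult (w K) = (\<Sum>A\<in>below K. of_nat (mbinom K A) \<cdot>\<^sub>S (w A \<otimes>\<^sub>S w (K - A)))"
proof (cases K rule: w_cases)
  case 1
  with assms have "K = (0, 0, 0)" by auto
  then show ?thesis by (simp add: comult_def linext_def below_sum)
next
  case (2 K')
  then show ?thesis by (simp add: comult_def)
qed

lemma pascal:
  fixes g :: "nat \<Rightarrow> nat \<Rightarrow> ('a \<Rightarrow>\<^sub>0 complex)"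
  shows "(\<Sum>a\<le>Suc m. of_nat (Suc m choose a) \<cdot>\<^sub>S g a (Suc m - a)) =
    (\<Sum>a\<le>m. of_nat (m choose a) \<cdot>\<^sub>S (g (Suc a) (m - a) + g a (Suc m - a)))"
proof -
  have "(\<Sum>a\<le>Suc m. of_nat (Suc m choose a) \<cdot>\<^sub>S g a (Suc m - a)) =
      g 0 (Suc m) + (\<Sum>a\<le>m. of_nat ((m choose a) + (m choose Suc a)) \<cdot>\<^sub>S g (Suc a) (m - a))"
    by (subst sum.atMost_Suc_shift)
      (simp only: binomial_Suc_Suc binomial_n_0 of_nat_1 S.scale_one minus_nat.diff_0 diff_Suc_Suc)
  also have "\<dots> = (\<Sum>a\<le>m. of_nat (m choose a) \<cdot>\<^sub>S g (Suc a) (m - a)) +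
      (g 0 (Suc m) + (\<Sum>a\<le>m. of_nat (m choose Suc a) \<cdot>\<^sub>S g (Suc a) (m - a)))"
    by (simp add: S.scale_left_distrib sum.distrib del: binomial_Suc_Suc)
  also have "g 0 (Suc m) + (\<Sum>a\<le>m. of_nat (m choose Suc a) \<cdot>\<^sub>S g (Suc a) (m - a)) =
      (\<Sum>a\<le>Suc m. of_nat (m choose a) \<cdot>\<^sub>S g a (Suc m - a))"
    by (subst sum.atMost_Suc_shift) simp
  also have "\<dots> = (\<Sum>a\<le>m. of_nat (m choose a) \<cdot>\<^sub>S g a (Suc m - a))"
    by (simp add: binomial_eq_0)
  finally show ?thesis
    by (simp add: S.scale_right_distrib sum.distrib)
qed


lemma comult_mult:
  assumes "fst M \<le> 1"
  shows "comult (w (unit_idx j + M)) = (\<Sum>A\<in>below M. of_nat (mbinom M A) \<cdot>\<^sub>S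
    (w (unit_idx j + A) \<otimes>\<^sub>S w (M - A) +
      (- 1) ^ (par_W j * fst A) \<cdot>\<^sub>S (w A \<otimes>\<^sub>S w (unit_idx j + (M - A)))))"
proof -
  obtain m1 m2 m3 where M: "M = (m1, m2, m3)" by (cases M)
  consider "j = 1" "m1 = 0" | "j = 1" "m1 = 1" | "j = 2" | "j = 3"
    using assms M exhaust_3[of j] by force
  then show ?thesis
  proof cases
    case 1
    then show ?thesis
      by (simp add: M unit_idx_def par_W_def comult_w below_sum sum.distrib
          S.scale_right_distrib add.commute)
  next
    case 2
    have "w (Suc (Suc 0), b, c) = 0" for b c by (simp add: w_def)
    with 2 show ?thesis
      by (simp add: M unit_idx_def par_W_def below_sum sum.distrib[symmetric]
          S.scale_right_distrib w_def[of "(Suc (Suc 0), _, _)"] comult_def linext_def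
        flip: S.scale_right_distrib)
  next
    case 3
    let ?g = "\<lambda>b b'. \<Sum>a\<le>m1. \<Sum>c\<le>m3. of_nat ((m1 choose a) * (m3 choose c)) \<cdot>\<^sub>S
      (w (a, b, c) \<otimes>\<^sub>S w (m1 - a, b', m3 - c))"
    have "comult (w (unit_idx j + M)) =
        (\<Sum>b\<le>Suc m2. of_nat (Suc m2 choose b) \<cdot>\<^sub>S ?g b (Suc m2 - b))"
      using assms 3
      by (simp add: M unit_idx_def comult_w below_sum S.scale_sum_right algebra_simps
          del: sum.atMost_Suc binomial_Suc_Suc) (rule sum.swap)
    also have "\<dots> = (\<Sum>b\<le>m2. of_nat (m2 choose b) \<cdot>\<^sub>S (?g (Suc b) (m2 - b) + ?g b (Suc m2 - b)))"
      by (rule pascal)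
    also have "\<dots> = (\<Sum>a\<le>m1. \<Sum>b\<le>m2. \<Sum>c\<le>m3. of_nat (mbinom M (a, b, c)) \<cdot>\<^sub>S
        (w (a, Suc b, c) \<otimes>\<^sub>S w (m1 - a, m2 - b, m3 - c) +
         w (a, b, c) \<otimes>\<^sub>S w (m1 - a, Suc m2 - b, m3 - c)))"
      by (subst sum.swap) (simp add: M sum.distrib[symmetric] S.scale_sum_right algebra_simps)
    also have "\<dots> = (\<Sum>a\<le>m1. \<Sum>b\<le>m2. \<Sum>c\<le>m3. of_nat (mbinom M (a, b, c)) \<cdot>\<^sub>S
        (w (a, Suc b, c) \<otimes>\<^sub>S w (m1 - a, m2 - b, m3 - c) +
         w (a, b, c) \<otimes>\<^sub>S w (m1 - a, Suc (m2 - b), m3 - c)))"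
      by (intro sum.cong refl) (simp add: Suc_diff_le)
    finally show ?thesis
      using 3 by (simp add: M unit_idx_def par_W_def below_sum)
  next
    case 4
    let ?g = "\<lambda>c c'. \<Sum>a\<le>m1. \<Sum>b\<le>m2. of_nat ((m1 choose a) * (m2 choose b)) \<cdot>\<^sub>S
      (w (a, b, c) \<otimes>\<^sub>S w (m1 - a, m2 - b, c'))"
    have "comult (w (unit_idx j + M)) =
        (\<Sum>a\<le>m1. \<Sum>b\<le>m2. \<Sum>c\<le>Suc m3. of_nat (Suc m3 choose c) \<cdot>\<^sub>S
          of_nat ((m1 choose a) * (m2 choose b)) \<cdot>\<^sub>S
          (w (a, b, c) \<otimes>\<^sub>S w (m1 - a, m2 - b, Suc m3 - c)))"
      using assms 4
      by (simp add: M unit_idx_def comult_w below_sum algebra_simps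
          del: sum.atMost_Suc binomial_Suc_Suc)
    also have "\<dots> = (\<Sum>c\<le>Suc m3. \<Sum>a\<le>m1. \<Sum>b\<le>m2. of_nat (Suc m3 choose c) \<cdot>\<^sub>S
          of_nat ((m1 choose a) * (m2 choose b)) \<cdot>\<^sub>S
          (w (a, b, c) \<otimes>\<^sub>S w (m1 - a, m2 - b, Suc m3 - c)))"
      by (subst (2) sum.swap, subst sum.swap) (rule refl)
    also have "\<dots> = (\<Sum>c\<le>Suc m3. of_nat (Suc m3 choose c) \<cdot>\<^sub>S ?g c (Suc m3 - c))"
      by (simp only: S.scale_sum_right)
    also have "\<dots> = (\<Sum>c\<le>m3. of_nat (m3 choose c) \<cdot>\<^sub>S (?g (Suc c) (m3 - c) + ?g c (Suc m3 - c)))"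
      by (rule pascal)
    also have "\<dots> = (\<Sum>c\<le>m3. \<Sum>a\<le>m1. \<Sum>b\<le>m2. of_nat (mbinom M (a, b, c)) \<cdot>\<^sub>S
        (w (a, b, Suc c) \<otimes>\<^sub>S w (m1 - a, m2 - b, m3 - c) +
         w (a, b, c) \<otimes>\<^sub>S w (m1 - a, m2 - b, Suc m3 - c)))"
      by (simp add: M sum.distrib[symmetric] S.scale_sum_right algebra_simps)
    also have "\<dots> = (\<Sum>c\<le>m3. \<Sum>a\<le>m1. \<Sum>b\<le>m2. of_nat (mbinom M (a, b, c)) \<cdot>\<^sub>S
        (w (a, b, Suc c) \<otimes>\<^sub>S w (m1 - a, m2 - b, m3 - c) +
         w (a, b, c) \<otimes>\<^sub>S w (m1 - a, m2 - b, Suc (m3 - c))))"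
      by (intro sum.cong refl) (simp add: Suc_diff_le)
    also have "\<dots> = (\<Sum>a\<le>m1. \<Sum>b\<le>m2. \<Sum>c\<le>m3. of_nat (mbinom M (a, b, c)) \<cdot>\<^sub>S
        (w (a, b, Suc c) \<otimes>\<^sub>S w (m1 - a, m2 - b, m3 - c) +
         w (a, b, c) \<otimes>\<^sub>S w (m1 - a, m2 - b, Suc (m3 - c))))"
      by (subst sum.swap, subst (2) sum.swap) (rule refl)
    finally show ?thesis
      using 4 by (simp add: M unit_idx_def par_W_def below_sum)
  qed
qed


lemma below_iff: "I \<in> below K \<longleftrightarrow>
    fst I \<le> fst K \<and> fst (snd I) \<le> fst (snd K) \<and> snd (snd I) \<le> snd (snd K)"
  by (cases I; cases K) (auto simp: below.simps)

lemma mindex_eq_iff: "I = K \<longleftrightarrow>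
    fst I = fst K \<and> fst (snd I) = fst (snd K) \<and> snd (snd I) = snd (snd K)" for I K :: mindex
  by (cases I; cases K) auto

lemma below_sum_shift:
  "(\<Sum>I\<in>below K. \<Sum>B\<in>below (K - I). f I B) = (\<Sum>A\<in>below K. \<Sum>I\<in>below A. f I (A - I))"
  unfolding sum.Sigma[OF finite_below ballI[OF finite_below]]
  by (rule sum.reindex_bij_witness[of _ "\<lambda>(A, I). (I, A - I)" "\<lambda>(I, B). (I + B, I)"])
    (auto simp: below_iff mindex_eq_iff)

lemma below_sum_swap:
  "(\<Sum>I\<in>below K. \<Sum>A\<in>below (K - I). f I A) = (\<Sum>A\<in>below K. \<Sum>I\<in>below (K - A). f I A)"
  unfolding sum.Sigma[OF finite_below ballI[OF finite_below]]
  by (rule sum.reindex_bij_witness[of _ "\<lambda>(A, I). (I, A)" "\<lambda>(I, A). (A, I)"])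
    (auto simp: below_iff)

lemma prod3_eqI:
  fixes x1 :: nat
  assumes "x1 * y1 = z1 * u1" "x2 * y2 = z2 * u2" "x3 * y3 = z3 * u3"
  shows "(x1 * x2 * x3) * (y1 * y2 * y3) = (z1 * z2 * z3) * (u1 * u2 * u3)"
proof -
  have "(x1 * x2 * x3) * (y1 * y2 * y3) = (x1 * y1) * (x2 * y2) * (x3 * y3)"
    by (simp only: mult_ac)
  also have "\<dots> = (z1 * z2 * z3) * (u1 * u2 * u3)"
    unfolding assms by (simp only: mult_ac)
  finally show ?thesis .
qed

lemma mbinom_mult:
  assumes "A \<in> below K" "I \<in> below A"
  shows "mbinom K I * mbinom (K - I) (A - I) = mbinom K A * mbinom A I"
proof -
  obtain k1 k2 k3 a1 a2 a3 i1 i2 i3 where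
    e: "K = (k1, k2, k3)" "A = (a1, a2, a3)" "I = (i1, i2, i3)"
    by (cases K; cases A; cases I)
  have "i1 \<le> a1" "a1 \<le> k1" "i2 \<le> a2" "a2 \<le> k2" "i3 \<le> a3" "a3 \<le> k3"
    using assms by (auto simp: e below_iff)
  then show ?thesis
    unfolding e diff_Pair mbinom.simps by (intro prod3_eqI) (simp_all only: choose_mult)
qed

lemma choose_swap:
  fixes k a i :: nat
  assumes "a + i \<le> k"
  shows "(k choose i) * ((k - i) choose a) = (k choose a) * ((k - a) choose i)"
proof -
  have "(k choose i) * ((k - i) choose a) = (k choose (a + i)) * ((a + i) choose i)"
    using assms choose_mult[of i "a + i" k] by simp
  moreover have "(k choose a) * ((k - a) choose i) = (k choose (a + i)) * ((a + i) choose a)"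
    using assms choose_mult[of a "a + i" k] by simp
  moreover have "((a + i) choose i) = ((a + i) choose a)"
    using binomial_symmetric[of i "a + i"] by simp
  ultimately show ?thesis by simp
qed

lemma mbinom_swap:
  assumes "A \<in> below K" "I \<in> below (K - A)"
  shows "mbinom K I * mbinom (K - I) A = mbinom K A * mbinom (K - A) I"
proof -
  obtain k1 k2 k3 a1 a2 a3 i1 i2 i3 where
    e: "K = (k1, k2, k3)" "A = (a1, a2, a3)" "I = (i1, i2, i3)"
    by (cases K; cases A; cases I)
  have "a1 + i1 \<le> k1" "a2 + i2 \<le> k2" "a3 + i3 \<le> k3"
    using assms by (auto simp: e below_iff)
  then show ?thesis
    unfolding e diff_Pair mbinom.simps by (intro prod3_eqI choose_swap)
qed

definition coder_monomial :: "(mindex \<Rightarrow> 3 \<Rightarrow> complex) \<Rightarrow> mindex \<Rightarrow> SW"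
  where "coder_monomial a K = (\<Sum>I\<in>below K. of_nat (mbinom K I) \<cdot>\<^sub>S
    (\<Sum>j\<in>UNIV. a I j \<cdot>\<^sub>S w (unit_idx j + (K - I))))"

interpretation comult: Vector_Spaces.linear "(\<cdot>\<^sub>S)" "(\<cdot>\<^sub>S)" comult
  unfolding comult_def by (rule linear_linext)

lemma comult_coder_monomial:
  assumes K: "fst K \<le> 1"
    and a: "\<And>I j. a I j \<noteq> 0 \<Longrightarrow> par_W j = (p + fst I) mod 2"
  shows "comult (coder_monomial a K) =
    (\<Sum>A\<in>below K. of_nat (mbinom K A) \<cdot>\<^sub>S (coder_monomial a A \<otimes>\<^sub>S w (K - A))) +
    (\<Sum>A\<in>below K. (of_nat (mbinom K A) * (- 1) ^ (p * fst A)) \<cdot>\<^sub>S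
      (w A \<otimes>\<^sub>S coder_monomial a (K - A)))"
proof -
  define f1 where "f1 I B = (\<Sum>j\<in>UNIV. (of_nat (mbinom K I * mbinom (K - I) B) * a I j) \<cdot>\<^sub>S
      (w (unit_idx j + B) \<otimes>\<^sub>S w (K - I - B)))" for I B
  define f2 where "f2 I B = (\<Sum>j\<in>UNIV. (of_nat (mbinom K I * mbinom (K - I) B) * a I j *
      (- 1) ^ (par_W j * fst B)) \<cdot>\<^sub>S (w B \<otimes>\<^sub>S w (unit_idx j + (K - I - B))))" for I B
  have K': "fst (K - I) \<le> 1" for I using K by simp
  have "comult (coder_monomial a K) = (\<Sum>I\<in>below K. \<Sum>B\<in>below (K - I). f1 I B + f2 I B)"
    unfolding coder_monomial_def comult.sum comult.scale comult_mult[OF K'] f1_def f2_def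
    by (intro sum.cong refl, simp only: S.scale_sum_right sum.distrib[symmetric],
        subst sum.swap, intro sum.cong refl)
      (simp add: S.scale_right_distrib mult_ac)
  also have "\<dots> = (\<Sum>I\<in>below K. \<Sum>B\<in>below (K - I). f1 I B) +
      (\<Sum>I\<in>below K. \<Sum>B\<in>below (K - I). f2 I B)"
    by (simp add: sum.distrib)
  also have "(\<Sum>I\<in>below K. \<Sum>B\<in>below (K - I). f1 I B) =
      (\<Sum>A\<in>below K. of_nat (mbinom K A) \<cdot>\<^sub>S (coder_monomial a A \<otimes>\<^sub>S w (K - A)))"
    unfolding below_sum_shift
  proof (intro sum.cong refl)
    fix A assume A: "A \<in> below K"
    have "f1 I (A - I) = of_nat (mbinom K A) \<cdot>\<^sub>S of_nat (mbinom A I) \<cdot>\<^sub>S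
        (\<Sum>j\<in>UNIV. a I j \<cdot>\<^sub>S (w (unit_idx j + (A - I)) \<otimes>\<^sub>S w (K - A)))" if "I \<in> below A" for I
    proof -
      have "K - I - (A - I) = K - A"
        using A that by (auto simp: below_iff mindex_eq_iff)
      then show ?thesis
        unfolding f1_def mbinom_mult[OF A that] S.scale_sum_right by (simp add: mult.assoc)
    qed
    then show "(\<Sum>I\<in>below A. f1 I (A - I)) =
        of_nat (mbinom K A) \<cdot>\<^sub>S (coder_monomial a A \<otimes>\<^sub>S w (K - A))"
      unfolding coder_monomial_def tensor_sum_left tensor_scale_left S.scale_sum_right[of _ _ "below A"]
      by (intro sum.cong) auto
  qed
  also have "(\<Sum>I\<in>below K. \<Sum>B\<in>below (K - I). f2 I B) =
      (\<Sum>A\<in>below K. (of_nat (mbinom K A) * (- 1) ^ (p * fst A)) \<cdot>\<^sub>S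
        (w A \<otimes>\<^sub>S coder_monomial a (K - A)))"
  proof (subst below_sum_swap, intro sum.cong refl)
    fix A assume A: "A \<in> below K"
    have "f2 I A = (of_nat (mbinom K A) * (- 1) ^ (p * fst A)) \<cdot>\<^sub>S of_nat (mbinom (K - A) I) \<cdot>\<^sub>S
        (\<Sum>j\<in>UNIV. a I j \<cdot>\<^sub>S (w A \<otimes>\<^sub>S w (unit_idx j + (K - A - I))))"
      if I: "I \<in> below (K - A)" for I
    proof -
      have eq: "K - I - A = K - A - I"
        by (auto simp: mindex_eq_iff)
      have "fst A = 0 \<or> (fst A = 1 \<and> fst I = 0)"
        using A I K by (auto simp: below_iff)
      then have sign: "a I j * (- 1) ^ (par_W j * fst A) = a I j * (- 1) ^ (p * fst A)" for j
        using a[of I j] by (cases "a I j = 0") (auto simp: minus_one_power_iff)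
      show ?thesis
        unfolding f2_def S.scale_sum_right eq mbinom_swap[OF A I] S.scale_scale
        by (intro sum.cong refl arg_cong2[where f = "(\<cdot>\<^sub>S)"])
          (simp only: mult.assoc[of _ "a I _" "(- 1) ^ _"] sign of_nat_mult, simp only: mult_ac)
    qed
    then show "(\<Sum>I\<in>below (K - A). f2 I A) =
        (of_nat (mbinom K A) * (- 1) ^ (p * fst A)) \<cdot>\<^sub>S (w A \<otimes>\<^sub>S coder_monomial a (K - A))"
      unfolding coder_monomial_def tensor_sum_right tensor_scale_right
        S.scale_sum_right[of _ _ "below (K - A)"]
      by (intro sum.cong) auto
  qed
  finally show ?thesis .
qed


lemma S_part_w: "S_part q (w M) = (if fst M = q then w M else 0)"
  by (cases M rule: w_cases) (auto simp: S_part_def linext_def par_def)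

interpretation S_part: Vector_Spaces.linear "(\<cdot>\<^sub>S)" "(\<cdot>\<^sub>S)" "S_part q"
  unfolding S_part_def by (rule linear_linext)

lemma linear_part:
  assumes "linear_S \<delta>"
  shows "linear_S (parity_part p \<delta>)"
proof -
  interpret \<delta>: Vector_Spaces.linear "(\<cdot>\<^sub>S)" "(\<cdot>\<^sub>S)" \<delta> by fact
  show ?thesis
    unfolding Vector_Spaces.linear_iff parity_part_def
    by (simp add: S.vector_space_axioms S_part.add S_part.scale \<delta>.add \<delta>.scale
        S.scale_right_distrib)
qed

lemma part_w:
  assumes "linear_S \<delta>" "p \<le> 1"
  shows "parity_part p \<delta> (w K) = S_part ((p + fst K) mod 2) (\<delta> (w K))"
proof -
  interpret \<delta>: Vector_Spaces.linear "(\<cdot>\<^sub>S)" "(\<cdot>\<^sub>S)" \<delta> by fact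
  have "fst K = 0 \<or> fst K = 1 \<or> w K = 0" by (auto simp: w_def)
  then show ?thesis
    by (auto simp: parity_part_def S_part_w \<delta>.zero S_part.zero)
qed

lemma w_linear_eqI:
  assumes "Vector_Spaces.linear (\<cdot>\<^sub>S) s f" "Vector_Spaces.linear (\<cdot>\<^sub>S) s g"
    and "\<And>K. f (w (Rep_midx K)) = g (w (Rep_midx K))"
  shows "f = g"
  by (rule linear_S_eqI[OF assms(1,2)]) (use assms(3) in simp)

definition extend_coder :: "(mindex \<Rightarrow> 3 \<Rightarrow> complex) \<Rightarrow> SW \<Rightarrow> SW"
  where "extend_coder a = linext (\<lambda>K. coder_monomial a (Rep_midx K))"

lemma linear_extend_coder: "linear_S (extend_coder a)"
  unfolding extend_coder_def by (rule linear_linext)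

lemma coder_monomial_0: "(\<And>j. a (0, 0, 0) j = 0) \<Longrightarrow> coder_monomial a (0, 0, 0) = 0"
  by (simp add: coder_monomial_def below_sum)

lemma extend_coder_w:
  assumes "\<And>I j. w I = 0 \<Longrightarrow> a I j = 0" "fst K \<le> 1"
  shows "extend_coder a (w K) = coder_monomial a K"
proof (cases K rule: w_cases)
  case 1
  with assms(2) have "K = (0, 0, 0)" by auto
  then show ?thesis
    using assms(1) by (simp add: extend_coder_def linext_def coder_monomial_0)
qed (simp add: extend_coder_def)

lemma parity_aux:
  fixes p k i u :: nat
  assumes "p \<le> 1" "k \<le> 1" "i \<le> k" "u \<le> 1" "u + k - i \<le> 1"
  shows "(p + k) mod 2 = u + k - i \<longleftrightarrow> u = (p + i) mod 2"
proof -
  have "p \<in> {0, 1}" "k \<in> {0, 1}" "i \<in> {0, 1}" "u \<in> {0, 1}" using assms by auto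
  with assms show ?thesis by auto
qed

lemma part_extend_coder:
  assumes "\<And>I j. w I = 0 \<Longrightarrow> a I j = 0" "p \<le> 1"
  shows "parity_part p (extend_coder a) =
    extend_coder (\<lambda>I j. if par_W j = (p + fst I) mod 2 then a I j else 0)" (is "_ = extend_coder ?a")
proof (rule w_linear_eqI[OF linear_part[OF linear_extend_coder] linear_extend_coder])
  fix K'
  define K where "K = Rep_midx K'"
  have K: "fst K \<le> 1" unfolding K_def by (rule Rep_midx_prop)
  have "parity_part p (extend_coder a) (w K) = S_part ((p + fst K) mod 2) (coder_monomial a K)"
    using assms K by (simp add: part_w linear_extend_coder extend_coder_w)
  also have "\<dots> = coder_monomial ?a K"
    unfolding coder_monomial_def S_part.sum S_part.scale
  proof (intro sum.cong refl arg_cong[where f = "\<lambda>x. _ \<cdot>\<^sub>S x"])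
    fix I j assume I: "I \<in> below K"
    have M: "fst (unit_idx j + (K - I)) = par_W j + fst K - fst I"
      using I by (auto simp: unit_idx_def par_W_def below_iff)
    have "w (unit_idx j + (K - I)) = 0 \<or>
        ((p + fst K) mod 2 = par_W j + fst K - fst I \<longleftrightarrow> par_W j = (p + fst I) mod 2)"
    proof (cases "par_W j + fst K - fst I \<le> 1")
      case True
      have "fst K \<le> 1" "fst I \<le> fst K" "par_W j \<le> 1"
        using K I by (auto simp: below_iff par_W_def)
      with True \<open>p \<le> 1\<close> have "(p + fst K) mod 2 = par_W j + fst K - fst I \<longleftrightarrow> par_W j = (p + fst I) mod 2"
        by (intro parity_aux)
      then show ?thesis ..
    next
      case False
      then show ?thesis by (simp add: w_def M del: fst_add fst_diff)
    qed
    then show "a I j \<cdot>\<^sub>S S_part ((p + fst K) mod 2) (w (unit_idx j + (K - I))) =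
        ?a I j \<cdot>\<^sub>S w (unit_idx j + (K - I))"
      by (auto simp: S_part_w M simp del: fst_add fst_diff)
  qed
  also have "\<dots> = extend_coder ?a (w K)"
    using assms(1) K by (intro extend_coder_w[symmetric]) auto
  finally show "parity_part p (extend_coder a) (w (Rep_midx K')) = extend_coder ?a (w (Rep_midx K'))"
    by (simp only: K_def)
qed

interpretation tensor_left: Vector_Spaces.linear "(\<cdot>\<^sub>S)" "(\<cdot>\<^sub>S)" "tensor_left \<delta>"
  unfolding tensor_left_def by (rule linear_linext)

interpretation tensor_right: Vector_Spaces.linear "(\<cdot>\<^sub>S)" "(\<cdot>\<^sub>S)" "tensor_right p \<delta>"
  unfolding tensor_right_def by (rule linear_linext)

lemma tensor_left_w:
  assumes "linear_S \<delta>"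
  shows "tensor_left \<delta> (w A \<otimes>\<^sub>S w B) = \<delta> (w A) \<otimes>\<^sub>S w B"
proof -
  interpret \<delta>: Vector_Spaces.linear "(\<cdot>\<^sub>S)" "(\<cdot>\<^sub>S)" \<delta> by fact
  show ?thesis
    by (cases A rule: w_cases; cases B rule: w_cases)
      (simp_all add: \<delta>.zero tensor_left.zero, simp add: tensor_left_def)
qed

lemma tensor_right_w:
  assumes "linear_S \<delta>"
  shows "tensor_right p \<delta> (w A \<otimes>\<^sub>S w B) = (- 1) ^ (p * fst A) \<cdot>\<^sub>S (w A \<otimes>\<^sub>S \<delta> (w B))"
proof -
  interpret \<delta>: Vector_Spaces.linear "(\<cdot>\<^sub>S)" "(\<cdot>\<^sub>S)" \<delta> by fact
  show ?thesis
    by (cases A rule: w_cases; cases B rule: w_cases)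
      (simp_all add: \<delta>.zero tensor_right.zero, simp add: tensor_right_def par_def)
qed

lemma coderivation_rhs_w:
  assumes "linear_S \<delta>" "fst K \<le> 1"
  shows "tensor_left \<delta> (comult (w K)) + tensor_right p \<delta> (comult (w K)) =
    (\<Sum>A\<in>below K. of_nat (mbinom K A) \<cdot>\<^sub>S (\<delta> (w A) \<otimes>\<^sub>S w (K - A))) +
    (\<Sum>A\<in>below K. (of_nat (mbinom K A) * (- 1) ^ (p * fst A)) \<cdot>\<^sub>S (w A \<otimes>\<^sub>S \<delta> (w (K - A))))"
  by (simp only: comult_w[OF assms(2)] tensor_left.sum tensor_right.sum tensor_left.scale
      tensor_right.scale tensor_left_w[OF assms(1)] tensor_right_w[OF assms(1)] S.scale_scale)

lemma linear_comp_S: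
  assumes "linear_S f" "linear_S g"
  shows "linear_S (\<lambda>x. g (f x))"
proof -
  interpret f: Vector_Spaces.linear "(\<cdot>\<^sub>S)" "(\<cdot>\<^sub>S)" f by fact
  interpret g: Vector_Spaces.linear "(\<cdot>\<^sub>S)" "(\<cdot>\<^sub>S)" g by fact
  show ?thesis
    unfolding Vector_Spaces.linear_iff
    by (simp add: S.vector_space_axioms f.add g.add f.scale g.scale)
qed

lemma coderivation_extend_coder:
  assumes a0: "\<And>I j. w I = 0 \<Longrightarrow> a I j = 0"
  shows "coderivation (extend_coder a)"
  unfolding coderivation_def
proof (intro conjI ballI allI linear_extend_coder)
  fix p :: nat and x assume "p \<in> {0, 1}"
  then have p: "p \<le> 1" by auto
  define b where "b = (\<lambda>I j. if par_W j = (p + fst I) mod 2 then a I j else 0)"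
  have b0: "\<And>I j. w I = 0 \<Longrightarrow> b I j = 0" by (simp add: b_def a0)
  have b1: "\<And>I j. b I j \<noteq> 0 \<Longrightarrow> par_W j = (p + fst I) mod 2"
    by (simp add: b_def split: if_splits)
  have part: "parity_part p (extend_coder a) = extend_coder b"
    unfolding b_def by (rule part_extend_coder[OF a0 p])
  have "(\<lambda>x. comult (extend_coder b x)) = (\<lambda>x. tensor_left (extend_coder b) (comult x) +
      tensor_right p (extend_coder b) (comult x))"
  proof (rule w_linear_eqI)
    show "linear_S (\<lambda>x. comult (extend_coder b x))"
      by (rule linear_comp_S[OF linear_extend_coder comult.linear_axioms])
    show "linear_S (\<lambda>x. tensor_left (extend_coder b) (comult x) +
        tensor_right p (extend_coder b) (comult x))"
      unfolding Vector_Spaces.linear_iff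
      by (simp add: S.vector_space_axioms comult.add comult.scale tensor_left.add tensor_right.add
          tensor_left.scale tensor_right.scale S.scale_right_distrib)
  next
    fix K'
    define K where "K = Rep_midx K'"
    have K: "fst K \<le> 1" unfolding K_def by (rule Rep_midx_prop)
    have A: "fst A \<le> 1" "fst (K - A) \<le> 1" if "A \<in> below K" for A
      using that K by (auto simp: below_iff)
    have E: "extend_coder b (w M) = coder_monomial b M" if "fst M \<le> 1" for M
      using b0 that by (rule extend_coder_w)
    have C: "comult (coder_monomial b K) =
        (\<Sum>A\<in>below K. of_nat (mbinom K A) \<cdot>\<^sub>S (coder_monomial b A \<otimes>\<^sub>S w (K - A))) +
        (\<Sum>A\<in>below K. (of_nat (mbinom K A) * (- 1) ^ (p * fst A)) \<cdot>\<^sub>S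
          (w A \<otimes>\<^sub>S coder_monomial b (K - A)))"
      using K b1 by (rule comult_coder_monomial)
    have "comult (extend_coder b (w K)) = tensor_left (extend_coder b) (comult (w K)) +
        tensor_right p (extend_coder b) (comult (w K))"
      unfolding coderivation_rhs_w[OF linear_extend_coder K] E[OF K] C
      by (intro arg_cong2[where f = "(+)"] sum.cong refl) (simp_all only: E[OF A(1)] E[OF A(2)])
    then show "comult (extend_coder b (w (Rep_midx K'))) =
        tensor_left (extend_coder b) (comult (w (Rep_midx K'))) +
        tensor_right p (extend_coder b) (comult (w (Rep_midx K')))"
      by (simp only: K_def)
  qed
  then show "comult (parity_part p (extend_coder a) x) =
      tensor_left (parity_part p (extend_coder a)) (comult x) +
      tensor_right p (parity_part p (extend_coder a)) (comult x)"
    unfolding part by (rule fun_cong)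
qed


lemma corestrict_extend_coder:
  assumes a0: "\<And>I j. w I = 0 \<Longrightarrow> a I j = 0" and K: "fst K \<le> 1"
  shows "corestrict (extend_coder a) (w K) $ j = a K j"
proof -
  have coeff: "coeff_S (w (unit_idx i + (K - I))) (unit_idx j) =
      (if I = K then if i = j then 1 else 0 else 0)" if I: "I \<in> below K" for I i
  proof -
    have "unit_idx j = unit_idx i + (K - I) \<longleftrightarrow> I = K \<and> i = j"
      using I exhaust_3[of i] exhaust_3[of j]
      by (auto simp: unit_idx_def below_iff mindex_eq_iff)
    then show ?thesis by (auto simp: coeff_S_w unit_idx_def)
  qed
  have E: "extend_coder a (w K) = coder_monomial a K"
    using a0 K by (rule extend_coder_w)
  have "corestrict (extend_coder a) (w K) $ j =
      (\<Sum>I\<in>below K. if I = K then of_nat (mbinom K I) * a I j else 0)"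
    unfolding corestrict_def vec_lambda_beta E coder_monomial_def coeff_S_sum coeff_S_scale
    by (intro sum.cong refl) (simp add: coeff if_distrib[of "(*) _"] cong: if_cong)
  also have "\<dots> = of_nat (mbinom K K) * a K j"
    by (simp add: below_iff)
  also have "mbinom K K = 1"
    by (cases K) simp
  finally show ?thesis by simp
qed

lemma linear_corestrict:
  assumes "linear_S \<delta>"
  shows "corestrict \<delta> \<in> Hom_SW"
proof -
  interpret \<delta>: Vector_Spaces.linear "(\<cdot>\<^sub>S)" "(\<cdot>\<^sub>S)" \<delta> by fact
  show ?thesis
    unfolding Hom_SW_def mem_Collect_eq Vector_Spaces.linear_iff
    by (simp add: S.vector_space_axioms vec.vector_space_axioms corestrict_def Finite_Cartesian_Product.vec_eq_iff
        \<delta>.add \<delta>.scale)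
qed

lemma fst_unit_idx: "fst (unit_idx j) = par_W j"
  by (simp add: unit_idx_def par_W_def)

lemma corestrict_S_part:
  "coeff_S (S_part q x) (unit_idx j) = (if par_W j = q then coeff_S x (unit_idx j) else 0)"
proof -
  have "linear_S (\<lambda>x. coeff_S (S_part q x) (unit_idx j) \<cdot>\<^sub>S w (unit_idx j))"
    "linear_S (\<lambda>x. (if par_W j = q then coeff_S x (unit_idx j) else 0) \<cdot>\<^sub>S w (unit_idx j))"
    unfolding Vector_Spaces.linear_iff
    by (simp_all add: S.vector_space_axioms S_part.add S_part.scale S.scale_left_distrib)
  then have "(\<lambda>x. coeff_S (S_part q x) (unit_idx j) \<cdot>\<^sub>S w (unit_idx j)) =
      (\<lambda>x. (if par_W j = q then coeff_S x (unit_idx j) else 0) \<cdot>\<^sub>S w (unit_idx j))"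
  proof (rule w_linear_eqI)
    fix K
    show "coeff_S (S_part q (w (Rep_midx K))) (unit_idx j) \<cdot>\<^sub>S w (unit_idx j) =
        (if par_W j = q then coeff_S (w (Rep_midx K)) (unit_idx j) else 0) \<cdot>\<^sub>S w (unit_idx j)"
      using fst_unit_idx[of j] unfolding S_part_w
      by (auto simp: coeff_S_w simp del: w_Rep)
  qed
  then have "coeff_S (S_part q x) (unit_idx j) \<cdot>\<^sub>S w (unit_idx j) =
      (if par_W j = q then coeff_S x (unit_idx j) else 0) \<cdot>\<^sub>S w (unit_idx j)"
    by (rule fun_cong)
  then have "coeff_S (coeff_S (S_part q x) (unit_idx j) \<cdot>\<^sub>S w (unit_idx j)) (unit_idx j) =
      coeff_S ((if par_W j = q then coeff_S x (unit_idx j) else 0) \<cdot>\<^sub>S w (unit_idx j)) (unit_idx j)"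
    by (rule arg_cong)
  then show ?thesis
    by (simp add: coeff_S_w) (auto simp: unit_idx_def split: if_splits)
qed

lemma coeff_S_Rep: "coeff_S x (Rep_midx K) = Poly_Mapping.lookup x K"
  using Rep_midx_prop[of K] by (auto simp: coeff_S_def Rep_midx_inverse)

lemma SW_eqI:
  assumes "\<And>K. fst K \<le> 1 \<Longrightarrow> K \<noteq> (0, 0, 0) \<Longrightarrow> coeff_S x K = coeff_S y K"
  shows "x = y"
  by (rule poly_mapping_eqI) (metis assms coeff_S_Rep Rep_midx_prop)

text \<open>The primitive elements of the coalgebra $S(W)$ are those of $W$.\<close>

lemma lookup_comult:
  assumes "fst A + fst B \<le> 1" "A \<noteq> (0, 0, 0)" "B \<noteq> (0, 0, 0)"
  shows "Poly_Mapping.lookup (comult x) (Abs_midx A, Abs_midx B) =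
    of_nat (mbinom (A + B) A) * coeff_S x (A + B)"
proof -
  have AB: "fst A \<le> 1" "fst B \<le> 1" "A + B \<noteq> (0, 0, 0)" "fst (A + B) \<le> 1"
    using assms by (auto simp: mindex_eq_iff)
  let ?c = "\<lambda>x. Poly_Mapping.lookup (comult x) (Abs_midx A, Abs_midx B)"
  let ?d = "\<lambda>x. of_nat (mbinom (A + B) A) * coeff_S x (A + B)"
  have "(\<lambda>x. ?c x \<cdot>\<^sub>S w A) = (\<lambda>x. ?d x \<cdot>\<^sub>S w A)"
  proof (rule w_linear_eqI)
    show "linear_S (\<lambda>x. ?c x \<cdot>\<^sub>S w A)" "linear_S (\<lambda>x. ?d x \<cdot>\<^sub>S w A)"
      unfolding Vector_Spaces.linear_iff
      by (simp_all add: S.vector_space_axioms comult.add comult.scale lookup_add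
          S.scale_left_distrib distrib_left mult_ac)
  next
    fix K'
    define K where "K = Rep_midx K'"
    have K: "fst K \<le> 1" unfolding K_def by (rule Rep_midx_prop)
    have l: "Poly_Mapping.lookup (w I) (Abs_midx J) = (if I = J then 1 else 0)"
      if "fst J \<le> 1" "J \<noteq> (0, 0, 0)" for I J
      using that coeff_S_w[of I J] by (auto simp: coeff_S_def)
    have "?c (w K) = (\<Sum>I\<in>below K. if I = A then (if K = A + B then of_nat (mbinom K A) else 0) else 0)"
      unfolding comult_w[OF K] lookup_sum lookup_sscale lookup_tensor l[OF AB(1) assms(2)]
        l[OF AB(2) assms(3)]
      by (intro sum.cong refl) (auto simp: below_iff mindex_eq_iff)
    also have "\<dots> = (if K = A + B then of_nat (mbinom K A) else 0)"
      by (auto simp: below_iff)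
    also have "\<dots> = ?d (w K)"
      using AB by (auto simp: coeff_S_w)
    finally show "?c (w (Rep_midx K')) \<cdot>\<^sub>S w A = ?d (w (Rep_midx K')) \<cdot>\<^sub>S w A"
      by (simp only: K_def)
  qed
  then have "coeff_S (?c x \<cdot>\<^sub>S w A) A = coeff_S (?d x \<cdot>\<^sub>S w A) A"
    by (metis)
  then show ?thesis
    using AB(1) assms(2) by (simp add: coeff_S_w)
qed

lemma primitive_eq_0:
  assumes "comult x = 0" "\<And>j. coeff_S x (unit_idx j) = 0"
  shows "x = 0"
proof (rule SW_eqI)
  fix K :: mindex assume K: "fst K \<le> 1" "K \<noteq> (0, 0, 0)"
  obtain k1 k2 k3 where k: "K = (k1, k2, k3)" by (cases K)
  obtain j where j: "unit_idx j \<in> below K"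
  proof -
    have "unit_idx 1 \<in> below K \<or> unit_idx 2 \<in> below K \<or> unit_idx 3 \<in> below K"
      using K by (auto simp: k unit_idx_def below_iff)
    then show ?thesis using that by blast
  qed
  let ?B = "K - unit_idx j"
  have KB: "unit_idx j + ?B = K"
    using j by (auto simp: below_iff mindex_eq_iff)
  have "coeff_S x K = 0"
  proof (cases "?B = (0, 0, 0)")
    case True
    then have "K = unit_idx j" using KB by (simp add: mindex_eq_iff)
    then show ?thesis using assms(2) by simp
  next
    case False
    have "fst (unit_idx j) + fst ?B \<le> 1" using K(1) by (metis KB fst_add)
    moreover have "unit_idx j \<noteq> (0, 0, 0)" by (auto simp: unit_idx_def)
    ultimately have "of_nat (mbinom K (unit_idx j)) * coeff_S x K = 0"
      using lookup_comult[of "unit_idx j" ?B x] False unfolding KB assms(1) by simp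
    moreover have "mbinom K (unit_idx j) \<noteq> 0"
      using j by (auto simp: k unit_idx_def below_iff)
    ultimately show ?thesis by simp
  qed
  then show "coeff_S x K = coeff_S 0 K" by simp
qed

lemma S_parts: "S_part 0 x + S_part 1 x = x"
proof -
  have "(\<lambda>x. S_part 0 x + S_part 1 x) = (\<lambda>x. x)"
  proof (rule w_linear_eqI)
    show "linear_S (\<lambda>x. S_part 0 x + S_part 1 x)" "linear_S (\<lambda>x :: SW. x)"
      unfolding Vector_Spaces.linear_iff
      by (simp_all add: S.vector_space_axioms S_part.add S_part.scale S.scale_right_distrib)
  next
    fix K
    show "S_part 0 (w (Rep_midx K)) + S_part 1 (w (Rep_midx K)) = w (Rep_midx K)"
      using Rep_midx_prop(1)[of K] unfolding S_part_w by auto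
  qed
  then show ?thesis by (rule fun_cong)
qed

lemma coderivation_parts_w:
  assumes "linear_S \<delta>" "fst K \<le> 1"
  shows "parity_part 0 \<delta> (w K) + parity_part 1 \<delta> (w K) = \<delta> (w K)"
proof -
  have "fst K = 0 \<or> fst K = 1" using assms(2) by auto
  then show ?thesis
    using S_parts[of "\<delta> (w K)"] by (auto simp: part_w[OF assms(1)] add.commute)
qed

lemma corestrict_part_w:
  assumes "linear_S \<delta>" "p \<le> 1"
  shows "coeff_S (parity_part p \<delta> (w K)) (unit_idx j) =
    (if par_W j = (p + fst K) mod 2 then corestrict \<delta> (w K) $ j else 0)"
  by (simp add: part_w[OF assms] corestrict_S_part corestrict_def)

lemma coderivation_parts_unique:
  assumes \<delta>: "coderivation \<delta>" and \<eta>: "coderivation \<eta>"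
    and eq: "corestrict \<delta> = corestrict \<eta>" and p: "p \<in> {0, 1}"
  shows "fst K \<le> 1 \<Longrightarrow> parity_part p \<delta> (w K) = parity_part p \<eta> (w K)"
proof (induction "mdeg K" arbitrary: K rule: less_induct)
  case (less K)
  note K = \<open>fst K \<le> 1\<close>
  have p': "p \<le> 1" using p by auto
  have lin: "linear_S \<delta>" "linear_S \<eta>" using \<delta> \<eta> by (auto simp: coderivation_def)
  note lin_part = lin[THEN linear_part]
  have IH: "parity_part p \<delta> (w A) = parity_part p \<eta> (w A)" if "A \<in> below K" "A \<noteq> K" for A
  proof (rule less(1))
    show "mdeg A < mdeg K"
      using that by (cases A; cases K) (auto simp: below_iff)
    show "fst A \<le> 1" using that K by (auto simp: below_iff)
  qed
  have rhs: "parity_part p \<delta> (w A) \<otimes>\<^sub>S w (K - A) = parity_part p \<eta> (w A) \<otimes>\<^sub>S w (K - A)"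
    "w A \<otimes>\<^sub>S parity_part p \<delta> (w (K - A)) = w A \<otimes>\<^sub>S parity_part p \<eta> (w (K - A))" if "A \<in> below K" for A
  proof -
    show "parity_part p \<delta> (w A) \<otimes>\<^sub>S w (K - A) = parity_part p \<eta> (w A) \<otimes>\<^sub>S w (K - A)"
    proof (cases "A = K")
      case True
      then have "K - A = (0, 0, 0)" by (simp add: mindex_eq_iff)
      then show ?thesis by simp
    qed (simp add: IH that)
    show "w A \<otimes>\<^sub>S parity_part p \<delta> (w (K - A)) = w A \<otimes>\<^sub>S parity_part p \<eta> (w (K - A))"
    proof (cases "A = (0, 0, 0)")
      case False
      then have "K - A \<noteq> K" using that by (auto simp: below_iff mindex_eq_iff)
      moreover have "K - A \<in> below K" by (auto simp: below_iff)
      ultimately show ?thesis by (simp add: IH)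
    qed simp
  qed
  have "comult (parity_part p \<delta> (w K)) = tensor_left (parity_part p \<delta>) (comult (w K)) +
      tensor_right p (parity_part p \<delta>) (comult (w K))"
    using \<delta> p unfolding coderivation_def by blast
  also have "\<dots> = tensor_left (parity_part p \<eta>) (comult (w K)) +
      tensor_right p (parity_part p \<eta>) (comult (w K))"
    unfolding coderivation_rhs_w[OF lin_part(1) K] coderivation_rhs_w[OF lin_part(2) K]
    by (intro arg_cong2[where f = "(+)"] sum.cong refl) (simp_all only: rhs)
  also have "\<dots> = comult (parity_part p \<eta> (w K))"
    using \<eta> p unfolding coderivation_def by metis
  finally have "comult (parity_part p \<delta> (w K) - parity_part p \<eta> (w K)) = 0"
    by (simp add: comult.diff)
  moreover have "coeff_S (parity_part p \<delta> (w K) - parity_part p \<eta> (w K)) (unit_idx j) = 0" for j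
  proof -
    have "coeff_S (x - y) I = coeff_S x I - coeff_S y I" for x y I
      by (simp add: coeff_S_def lookup_minus)
    then show ?thesis
      by (simp add: corestrict_part_w[OF lin(1) p'] corestrict_part_w[OF lin(2) p'] eq)
  qed
  ultimately have "parity_part p \<delta> (w K) - parity_part p \<eta> (w K) = 0"
    by (rule primitive_eq_0)
  then show ?case by simp
qed

lemma coderivation_eqI:
  assumes "coderivation \<delta>" "coderivation \<eta>" "corestrict \<delta> = corestrict \<eta>"
  shows "\<delta> = \<eta>"
proof (rule w_linear_eqI)
  show lin: "linear_S \<delta>" "linear_S \<eta>" using assms by (auto simp: coderivation_def)
  fix K
  show "\<delta> (w (Rep_midx K)) = \<eta> (w (Rep_midx K))"
    using coderivation_parts_unique[OF assms _ Rep_midx_prop(1), of 0 K]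
      coderivation_parts_unique[OF assms _ Rep_midx_prop(1), of 1 K]
      coderivation_parts_w[OF lin(1) Rep_midx_prop(1)[of K]]
      coderivation_parts_w[OF lin(2) Rep_midx_prop(1)[of K]]
    by simp
qed

lemma coderivation_existence:
  assumes "\<phi> \<in> Hom_SW"
  shows "corestrict (extend_coder (\<lambda>I j. \<phi> (w I) $ j)) = \<phi>"
    and "coderivation (extend_coder (\<lambda>I j. \<phi> (w I) $ j))"
proof -
  have lin: "Vector_Spaces.linear (\<cdot>\<^sub>S) (*s) \<phi>" using assms by (simp add: Hom_SW_def)
  interpret \<phi>: Vector_Spaces.linear "(\<cdot>\<^sub>S)" "(*s)" \<phi> by fact
  have a0: "\<phi> (w I) $ j = 0" if "w I = 0" for I j
    using that by (simp add: \<phi>.zero)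
  show "coderivation (extend_coder (\<lambda>I j. \<phi> (w I) $ j))"
    using a0 by (rule coderivation_extend_coder)
  show "corestrict (extend_coder (\<lambda>I j. \<phi> (w I) $ j)) = \<phi>"
  proof (rule w_linear_eqI[OF _ lin])
    show "Vector_Spaces.linear (\<cdot>\<^sub>S) (*s) (corestrict (extend_coder (\<lambda>I j. \<phi> (w I) $ j)))"
      using linear_corestrict[OF linear_extend_coder] by (simp add: Hom_SW_def)
    fix K
    have "corestrict (extend_coder (\<lambda>I j. \<phi> (w I) $ j)) (w (Rep_midx K)) $ j =
        \<phi> (w (Rep_midx K)) $ j" for j
      by (rule corestrict_extend_coder[where a = "\<lambda>I j. \<phi> (w I) $ j"])
        (simp_all only: a0 Rep_midx_prop \<phi>.zero zero_index)
    then show "corestrict (extend_coder (\<lambda>I j. \<phi> (w I) $ j)) (w (Rep_midx K)) =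
        \<phi> (w (Rep_midx K))"
      by (simp only: Finite_Cartesian_Product.vec_eq_iff simp_thms)
  qed
qed

theorem coder_unique:
  assumes "\<phi> \<in> Hom_SW"
  shows "\<exists>!\<delta>. coderivation \<delta> \<and> corestrict \<delta> = \<phi>"
  using coderivation_existence[OF assms] coderivation_eqI by metis

theorem bij_betw_coder: "bij_betw coder Hom_SW {\<delta>. coderivation \<delta>}"
proof (rule bij_betw_byWitness[where f' = corestrict])
  have *: "coderivation (coder \<phi>) \<and> corestrict (coder \<phi>) = \<phi>" if "\<phi> \<in> Hom_SW" for \<phi>
    unfolding coder_def by (rule theI'[OF coder_unique[OF that]])
  have **: "corestrict \<delta> \<in> Hom_SW" if "coderivation \<delta>" for \<delta>
    using that by (intro linear_corestrict) (simp add: coderivation_def)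
  show "\<forall>\<phi>\<in>Hom_SW. corestrict (coder \<phi>) = \<phi>" using * by blast
  show "coder ` Hom_SW \<subseteq> {\<delta>. coderivation \<delta>}" using * by blast
  show "corestrict ` {\<delta>. coderivation \<delta>} \<subseteq> Hom_SW" using ** by blast
  show "\<forall>\<delta>\<in>{\<delta>. coderivation \<delta>}. coder (corestrict \<delta>) = \<delta>"
    using * ** coderivation_eqI by blast
qed

text \<open>The explicit form: the coderivation of $\varphi^I_j$ is the differential operator
  $w_j \partial_I$.\<close>

theorem coder_w:
  assumes "\<phi> \<in> Hom_SW" "fst K \<le> 1"
  shows "coder \<phi> (w K) = (\<Sum>I\<in>below K. of_nat (mbinom K I) \<cdot>\<^sub>S
    (\<Sum>j\<in>UNIV. \<phi> (w I) $ j \<cdot>\<^sub>S w (unit_idx j + (K - I))))"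
proof -
  interpret \<phi>: Vector_Spaces.linear "(\<cdot>\<^sub>S)" "(*s)" \<phi> using assms(1) by (simp add: Hom_SW_def)
  have "coder \<phi> = extend_coder (\<lambda>I j. \<phi> (w I) $ j)"
    unfolding coder_def using coderivation_existence[OF assms(1)] coder_unique[OF assms(1)]
    by (intro the1_equality) auto
  moreover have "extend_coder (\<lambda>I j. \<phi> (w I) $ j) (w K) = coder_monomial (\<lambda>I j. \<phi> (w I) $ j) K"
    by (rule extend_coder_w) (simp_all only: \<phi>.zero zero_index assms(2))
  ultimately show ?thesis by (simp only: coder_monomial_def)
qed

end

theory Submission
  imports Defs
begin

text \<open>Writing an element of $L$ as a differential operator $\sum_j w_j (A_j + B_j \partial_1)$ with
  $A_j$, $B_j$ polynomials in $\partial_2, \partial_3$, and $d = w_1 Q(\partial_2, \partial_3)$ with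
  partial derivatives $Q_2, Q_3$, the element $D\varphi$ has
  $A_1' = B_1 Q - Q_2 A_2 - Q_3 A_3$, $A_2' = B_2 Q$, $A_3' = B_3 Q$, $B_1' = Q_2 B_2 + Q_3 B_3$
  and $B_2' = B_3' = 0$. For $Q = \partial_2 \partial_3$ and $Q = \partial_2^2$, cocycles and
  coboundaries are read off coefficientwise. In each case the listed cocycles are dual, modulo
  coboundaries, to a list of coefficients: these vanish on coboundaries, and a cocycle on which
  all of them vanish is a coboundary.\<close>

section \<open>The bracket with $w_1 \partial_2^a \partial_3^b$ in coordinates\<close>

lemma Hom_SW_iff:
  "\<phi> \<in> Hom_SW \<longleftrightarrow> (\<forall>x y. \<phi> (x + y) = \<phi> x + \<phi> y) \<and> (\<forall>c x. \<phi> (c \<cdot>\<^sub>S x) = c *s \<phi> x)"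
  unfolding Hom_SW_def mem_Collect_eq Vector_Spaces.linear_iff
  by (simp only: S.vector_space_axioms vec.vector_space_axioms simp_thms)

lemma linear_S_iff:
  "linear_S f \<longleftrightarrow> (\<forall>x y. f (x + y) = f x + f y) \<and> (\<forall>c x. f (c \<cdot>\<^sub>S x) = c \<cdot>\<^sub>S f x)"
  unfolding Vector_Spaces.linear_iff by (simp only: S.vector_space_axioms simp_thms)

lemma Hom_SW_eqI:
  assumes "\<phi> \<in> Hom_SW" "\<psi> \<in> Hom_SW"
    and "\<And>K. fst K \<le> 1 \<Longrightarrow> K \<noteq> (0, 0, 0) \<Longrightarrow> \<phi> (w K) = \<psi> (w K)"
  shows "\<phi> = \<psi>"
proof (rule w_linear_eqI)
  show "\<phi> (w (Rep_midx K)) = \<psi> (w (Rep_midx K))" for K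
    by (intro assms(3) Rep_midx_prop)
qed (use assms in \<open>simp_all add: Hom_SW_def\<close>)

lemma phi_Hom: "phi I j \<in> Hom_SW"
  by (simp add: Hom_SW_iff phi_def algebra_simps)

lemma coder_coderivation:
  assumes "\<phi> \<in> Hom_SW"
  shows "coderivation (coder \<phi>)" "corestrict (coder \<phi>) = \<phi>" "linear_S (coder \<phi>)"
  using theI'[OF coder_unique[OF assms]] by (auto simp: coder_def coderivation_def)

text \<open>This is w_j \<partial>_I on a monomial: the binomials times I! form the falling
  factorials. If I is not below K, truncated subtraction makes K - I meaningless, but then a
  binomial factor is 0.\<close>

lemma coder_phi_w:
  assumes "fst K \<le> 1" "I \<noteq> (0, 0, 0)" "fst I \<le> 1"
  shows "coder (phi I j) (w K) =
    of_nat (mbinom K I * mfact I) \<cdot>\<^sub>S w (unit_idx j + (K - I))"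
proof -
  have *: "phi I j (w I') $ i = (if I = I' then if i = j then of_nat (mfact I) else 0 else 0)" for I' i
    by (simp add: phi_w[OF assms(3,2)] axis_def)
  have z: "mbinom K I = 0" if "I \<notin> below K"
    using that by (cases K; cases I) (auto simp: below_iff binomial_eq_0)
  have "coder (phi I j) (w K) = (\<Sum>I'\<in>below K. if I = I' then
      of_nat (mbinom K I * mfact I) \<cdot>\<^sub>S w (unit_idx j + (K - I)) else 0)"
    unfolding coder_w[OF phi_Hom assms(1)] *
    by (intro sum.cong refl) (simp add: if_distrib[of "\<lambda>x. x \<cdot>\<^sub>S _"] cong: if_cong)
  then show ?thesis using z by auto
qed

section \<open>Parity components and the bracket as a combination of compositions\<close>

lemma parity_parts_add:
  assumes "linear_S \<delta>"
  shows "parity_part 0 \<delta> x + parity_part 1 \<delta> x = \<delta> x"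
proof -
  have "parity_part 0 \<delta> x + parity_part 1 \<delta> x =
     (S_part 0 (\<delta> (S_part 0 x)) + S_part 1 (\<delta> (S_part 0 x))) +
     (S_part 0 (\<delta> (S_part 1 x)) + S_part 1 (\<delta> (S_part 1 x)))"
    by (simp add: parity_part_def)
  also have "\<dots> = \<delta> (S_part 0 x + S_part 1 x)"
    using assms unfolding linear_S_iff by (metis S_parts)
  finally show ?thesis by (simp add: S_parts del: One_nat_def)
qed

lemma coeff_S_S_part: "coeff_S (S_part q x) I = (if fst I = q then coeff_S x I else 0)"
proof (cases I rule: w_cases)
  case 1
  then show ?thesis by (simp only: coeff_S_def if_False if_cancel)
next
  case (2 K)
  have "Poly_Mapping.lookup (S_part q x) K = (\<Sum>J\<in>Poly_Mapping.keys x.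
      if J = K then if par K = q then Poly_Mapping.lookup x K else 0 else 0)"
    unfolding S_part_def lookup_linext by (intro sum.cong refl) (simp add: lookup_single when_def)
  then have "Poly_Mapping.lookup (S_part q x) K = (if par K = q then Poly_Mapping.lookup x K else 0)"
    by (simp add: in_keys_iff)
  then show ?thesis by (simp add: 2 coeff_S_Rep par_def)
qed

text \<open>The operator w_1 \<partial>_I with i_1 = 0 adds one odd factor to every monomial it does
  not kill, so it is purely odd.\<close>

lemma parity_part_coder_phi:
  assumes "fst I = 0" "I \<noteq> (0, 0, 0)"
  shows "parity_part 0 (coder (phi I 1)) = (\<lambda>x. 0)"
    and "parity_part 1 (coder (phi I 1)) = coder (phi I 1)"
proof -
  have lin: "linear_S (coder (phi I 1))" by (rule coder_coderivation[OF phi_Hom])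
  have *: "parity_part p (coder (phi I 1)) (w K) = (if p = 1 then coder (phi I 1) (w K) else 0)"
    if "fst K \<le> 1" "p \<le> 1" for K p
  proof -
    have "fst (unit_idx 1 + (K - I)) = 1 + fst K" using assms(1) by (simp add: unit_idx_def)
    \<comment> \<open>On a monomial that already contains w_1 the result contains w_1^2 = 0.\<close>
    moreover have "fst K = 0 \<or> w (unit_idx 1 + (K - I)) = 0"
      using that assms(1) by (auto simp: w_def unit_idx_def)
    ultimately show ?thesis
      using assms that
      by (auto simp: part_w[OF lin] coder_phi_w S_part.scale S_part_w simp del: fst_add)
  qed
  show "parity_part 0 (coder (phi I 1)) = (\<lambda>x. 0)"
  proof (rule w_linear_eqI[OF linear_part[OF lin]])
    show "linear_S (\<lambda>x :: SW. 0 :: SW)" by (simp add: linear_S_iff)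
    show "parity_part 0 (coder (phi I 1)) (w (Rep_midx K)) = 0" for K
      by (subst *[OF Rep_midx_prop(1)]) simp_all
  qed
  show "parity_part 1 (coder (phi I 1)) = coder (phi I 1)"
  proof (rule w_linear_eqI[OF linear_part[OF lin] lin])
    show "parity_part 1 (coder (phi I 1)) (w (Rep_midx K)) = coder (phi I 1) (w (Rep_midx K))" for K
      by (subst *[OF Rep_midx_prop(1)]) simp_all
  qed
qed

text \<open>The second argument is purely odd, so only q = 1 survives in the graded commutator. The
  Koszul sign gives \<beta>\<alpha>_1 a plus, and the terms \<alpha>_0\<beta> and \<alpha>_1\<beta>
  recombine to \<alpha>\<beta>. Corestriction replaces the outer coderivation by the map it comes
  from.\<close>

lemma bracket_phi:
  assumes "\<phi> \<in> Hom_SW" "fst I = 0" "I \<noteq> (0, 0, 0)"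
  shows "bracket \<phi> (phi I 1) = (\<lambda>x. \<phi> (coder (phi I 1) x) -
    phi I 1 (parity_part 0 (coder \<phi>) x) + phi I 1 (parity_part 1 (coder \<phi>) x))"
proof
  fix x
  let ?\<alpha> = "coder \<phi>" and ?\<beta> = "coder (phi I 1)"
  note \<alpha> = coder_coderivation[OF assms(1)] and \<beta> = coder_coderivation[OF phi_Hom[of I 1]]
  have 0: "parity_part p ?\<alpha> 0 = 0" "?\<beta> 0 = 0" for p
    using linear_part[OF \<alpha>(3), of p] \<beta>(3)
    by (metis Vector_Spaces.linear_iff S.scale_zero_left)+
  have "graded_commutator ?\<alpha> ?\<beta> x = (parity_part 0 ?\<alpha> (?\<beta> x) + parity_part 1 ?\<alpha> (?\<beta> x)) -
      ?\<beta> (parity_part 0 ?\<alpha> x) + ?\<beta> (parity_part 1 ?\<alpha> x)"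
    using parity_part_coder_phi[OF assms(2,3)]
    by (simp add: graded_commutator_def 0)
  then have "graded_commutator ?\<alpha> ?\<beta> x = ?\<alpha> (?\<beta> x) -
      ?\<beta> (parity_part 0 ?\<alpha> x) + ?\<beta> (parity_part 1 ?\<alpha> x)"
    by (simp only: parity_parts_add[OF \<alpha>(3)])
  then have "bracket \<phi> (phi I 1) x = corestrict ?\<alpha> (?\<beta> x) -
      corestrict ?\<beta> (parity_part 0 ?\<alpha> x) + corestrict ?\<beta> (parity_part 1 ?\<alpha> x)"
    by (simp add: bracket_def corestrict_def Finite_Cartesian_Product.vec_eq_iff coeff_S_def lookup_minus lookup_add)
  then show "bracket \<phi> (phi I 1) x = \<phi> (coder (phi I 1) x) -
    phi I 1 (parity_part 0 (coder \<phi>) x) + phi I 1 (parity_part 1 (coder \<phi>) x)"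
    by (simp only: \<alpha> \<beta>)
qed

lemma bracket_phi_Hom:
  assumes "\<phi> \<in> Hom_SW" "fst I = 0" "I \<noteq> (0, 0, 0)"
  shows "bracket \<phi> (phi I 1) \<in> Hom_SW"
proof -
  note lin = linear_part[OF coder_coderivation(3)[OF assms(1)]]
    coder_coderivation(3)[OF phi_Hom[of I 1]]
  show ?thesis
    using assms(1) phi_Hom[of I 1] lin unfolding bracket_phi[OF assms] Hom_SW_iff linear_S_iff
    by (simp add: vec.scale_right_distrib vec.scale_right_diff_distrib)
qed

text \<open>Dividing by $I!$ makes these the coordinates with respect to the $\varphi^I_j$.\<close>

definition coord :: "(SW \<Rightarrow> W) \<Rightarrow> mindex \<Rightarrow> 3 \<Rightarrow> complex"
  where "coord \<phi> I j = \<phi> (w I) $ j / of_nat (mfact I)"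

lemma mfact_nz [simp]: "mfact I \<noteq> 0"
  by (cases I) auto

lemma w_coord: "\<phi> (w I) $ j = of_nat (mfact I) * coord \<phi> I j"
  by (simp add: coord_def)

section \<open>The coefficients of D\<close>

lemma mbinom_mfact:
  assumes "I \<in> below K"
  shows "mbinom K I * mfact I * mfact (K - I) = mfact K"
proof -
  obtain k1 k2 k3 i1 i2 i3 where e: "K = (k1, k2, k3)" "I = (i1, i2, i3)"
    by (cases K; cases I)
  have c: "(k choose i) * (fact i * fact (k - i)) = fact k" if "i \<le> k" for i k :: nat
    using binomial_fact_lemma[OF that] by (simp add: mult_ac)
  have "mbinom K I * mfact I * mfact (K - I) =
    ((k1 choose i1) * (fact i1 * fact (k1 - i1))) * ((k2 choose i2) * (fact i2 * fact (k2 - i2))) *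
    ((k3 choose i3) * (fact i3 * fact (k3 - i3)))"
    by (simp only: e diff_Pair mbinom.simps mfact.simps mult_ac)
  then show ?thesis
    using assms by (simp only: c) (simp add: e below_iff c)
qed

text \<open>Write J = (0,a,b) and e_j for \<open>unit_idx j\<close>. Only I with e_j + (K - I) = J
  contributes. For M = J - e_j, the identity J! = J_j M! and cancellation of factorials leave K!
  J_j. The factor J_j is the source of the derivatives Q_2 and Q_3 in D.\<close>

lemma coeff_coder:
  assumes "\<phi> \<in> Hom_SW" "k \<le> 1" "(0::nat, a, b) \<noteq> (0, 0, 0)"
  shows "of_nat (mfact (0, a, b)) * coeff_S (coder \<phi> (w (k, p, q))) (0, a, b) =
    of_nat (mfact (k, p, q)) *
     ((if 0 < a \<and> a - 1 \<le> p \<and> b \<le> q then of_nat a * coord \<phi> (k, p - (a - 1), q - b) 2 else 0) +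
      (if 0 < b \<and> a \<le> p \<and> b - 1 \<le> q then of_nat b * coord \<phi> (k, p - a, q - (b - 1)) 3 else 0))"
proof -
  let ?K = "(k, p, q)" and ?J = "(0::nat, a, b)"
  \<comment> \<open>Treats j = 2 and j = 3 at once: c is the exponent of w_j in J and M is J with
    one factor w_j removed. For c = 0 the truncated M is a dummy and the sum is 0.\<close>
  have S: "of_nat (mfact ?J) * (\<Sum>I\<in>below ?K. of_nat (mbinom ?K I) *
        (\<phi> (w I) $ j * coeff_S (w (unit_idx j + (?K - I))) ?J)) =
      (if M \<in> below ?K \<and> 0 < c then of_nat (mfact ?K) * (of_nat c * coord \<phi> (?K - M) j) else 0)"
    if cM: "mfact ?J = c * mfact M \<or> c = 0"
      "\<And>M'. unit_idx j + M' = ?J \<longleftrightarrow> 0 < c \<and> M' = M" for j c M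
  proof -
    have "of_nat (mfact ?J) * (\<Sum>I\<in>below ?K. of_nat (mbinom ?K I) *
        (\<phi> (w I) $ j * coeff_S (w (unit_idx j + (?K - I))) ?J)) =
      of_nat (mfact ?J) * (\<Sum>I\<in>below ?K. if I = ?K - M then
        if M \<in> below ?K \<and> 0 < c then of_nat (mbinom ?K I) * (of_nat (mfact I) * coord \<phi> I j) else 0 else 0)"
    proof (intro arg_cong2[where f = "(*)"] refl sum.cong)
      fix I assume I: "I \<in> below ?K"
      \<comment> \<open>The map I to K - I reflects the index set, so at most one I yields M, and
        only if M is itself below K.\<close>
      have "?K - I = M \<longleftrightarrow> I = ?K - M \<and> M \<in> below ?K"
        using I by (auto simp: below_iff mindex_eq_iff)
      then show "of_nat (mbinom ?K I) * (\<phi> (w I) $ j * coeff_S (w (unit_idx j + (?K - I))) ?J) =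
         (if I = ?K - M then
        if M \<in> below ?K \<and> 0 < c then of_nat (mbinom ?K I) * (of_nat (mfact I) * coord \<phi> I j) else 0 else 0)"
        using assms(3) cM(2)[of "?K - I"] by (auto simp: coeff_S_w w_coord)
    qed
    also have "\<dots> = (if M \<in> below ?K \<and> 0 < c then of_nat (mfact ?J) *
         (of_nat (mbinom ?K (?K - M)) * (of_nat (mfact (?K - M)) * coord \<phi> (?K - M) j)) else 0)"
      by (simp add: below_iff)
    also have "\<dots> = (if M \<in> below ?K \<and> 0 < c then of_nat (mfact ?K) * (of_nat c * coord \<phi> (?K - M) j) else 0)"
    proof (cases "M \<in> below ?K \<and> 0 < c")
      case True
      have 1: "?K - M \<in> below ?K" "?K - (?K - M) = M"
        using True by (auto simp: below_iff mindex_eq_iff)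
      have "mfact ?K = mbinom ?K (?K - M) * mfact (?K - M) * mfact M"
        using mbinom_mfact[OF 1(1)] unfolding 1(2) by simp
      moreover have "mfact ?J = c * mfact M" using cM(1) True by simp
      ultimately show ?thesis using True by (simp only: of_nat_mult mult_ac if_True)
    qed auto
    finally show ?thesis .
  qed
  have f: "fact n = n * fact (n - 1) \<or> n = (0::nat)" for n
    by (cases n) auto
  have 2: "of_nat (mfact ?J) * (\<Sum>I\<in>below ?K. of_nat (mbinom ?K I) *
        (\<phi> (w I) $ 2 * coeff_S (w (unit_idx 2 + (?K - I))) ?J)) =
      (if (0, a - 1, b) \<in> below ?K \<and> 0 < a then
        of_nat (mfact ?K) * (of_nat a * coord \<phi> (?K - (0, a - 1, b)) 2) else 0)"
  proof (rule S)
    show "mfact (0, a, b) = a * mfact (0, a - 1, b) \<or> a = 0"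
      using f[of a] by (auto simp: mult_ac)
  qed (auto simp: unit_idx_def mindex_eq_iff)
  have 3: "of_nat (mfact ?J) * (\<Sum>I\<in>below ?K. of_nat (mbinom ?K I) *
        (\<phi> (w I) $ 3 * coeff_S (w (unit_idx 3 + (?K - I))) ?J)) =
      (if (0, a, b - 1) \<in> below ?K \<and> 0 < b then
        of_nat (mfact ?K) * (of_nat b * coord \<phi> (?K - (0, a, b - 1)) 3) else 0)"
  proof (rule S)
    show "mfact (0, a, b) = b * mfact (0, a, b - 1) \<or> b = 0"
      using f[of b] by (auto simp: mult_ac)
  qed (auto simp: unit_idx_def mindex_eq_iff)
  \<comment> \<open>For j = 1 the monomial would contain w_1, which J does not.\<close>
  have 1: "coeff_S (w (unit_idx 1 + (?K - I))) ?J = 0" for I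
    by (auto simp: coeff_S_w unit_idx_def mindex_eq_iff)
  have "of_nat (mfact ?J) * coeff_S (coder \<phi> (w ?K)) ?J =
      of_nat (mfact ?J) * (\<Sum>I\<in>below ?K. of_nat (mbinom ?K I) *
        (\<phi> (w I) $ 2 * coeff_S (w (unit_idx 2 + (?K - I))) ?J)) +
      of_nat (mfact ?J) * (\<Sum>I\<in>below ?K. of_nat (mbinom ?K I) *
        (\<phi> (w I) $ 3 * coeff_S (w (unit_idx 3 + (?K - I))) ?J))"
  proof -
    have "fst ?K \<le> 1" using assms(2) by simp
    show ?thesis
      by (simp only: coder_w[OF assms(1) \<open>fst ?K \<le> 1\<close>] coeff_S_sum coeff_S_scale coeff_S_add
        sum_3 1 distrib_left sum.distrib mult_zero_right add_0_left)
  qed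
  then show ?thesis
    unfolding 2 3 by (simp only: below_iff) (auto simp: distrib_left simp del: mfact.simps)
qed

text \<open>The first term is \<phi> after d: d sends w_K to a multiple of w_1 w_2^(p-a) w_3^(q-b),
  and the factorials cancel. The second is d after the coderivation of \<phi>, evaluated by
  \<open>coeff_coder\<close>.\<close>

lemma coord_bracket:
  assumes "\<phi> \<in> Hom_SW" "k \<le> 1" "(0::nat, a, b) \<noteq> (0, 0, 0)"
  shows "coord (bracket \<phi> (phi (0, a, b) 1)) (k, p, q) j =
    (if a \<le> p \<and> b \<le> q then coord \<phi> (k + 1, p - a, q - b) j else 0) -
    (if j = 1 then (- 1) ^ k *
     ((if 0 < a \<and> a - 1 \<le> p \<and> b \<le> q then of_nat a * coord \<phi> (k, p - (a - 1), q - b) 2 else 0) +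
      (if 0 < b \<and> a \<le> p \<and> b - 1 \<le> q then of_nat b * coord \<phi> (k, p - a, q - (b - 1)) 3 else 0)) else 0)"
  (is "_ = _ - (if j = 1 then _ * ?R else 0)")
proof -
  let ?K = "(k, p, q)" and ?J = "(0::nat, a, b)"
  have k: "k = 0 \<or> k = 1" using assms(2) by auto
  note lin = coder_coderivation(3)[OF assms(1)]
  have \<phi>: "\<phi> (c \<cdot>\<^sub>S x) = c *s \<phi> x" for c x using assms(1) by (simp add: Hom_SW_iff)
  have w2: "w (Suc (Suc 0), x) = 0" for x by (cases x) (simp add: w_def)
  have \<phi>0: "\<phi> 0 = 0" using \<phi>[of 0 0] by simp
  \<comment> \<open>For k = 1 both sides are 0: the image of w_K under d contains w_1^2, and a
    multi-index with first entry k + 1 = 2 has w_I = 0.\<close>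
  have A: "\<phi> (coder (phi ?J 1) (w ?K)) $ j = of_nat (mfact ?K) *
      (if a \<le> p \<and> b \<le> q then coord \<phi> (k + 1, p - a, q - b) j else 0)"
  proof (cases "a \<le> p \<and> b \<le> q \<and> k = 0")
    case True
    have "mfact ?K = mbinom ?K ?J * mfact ?J * mfact (?K - ?J)"
      using True by (intro mbinom_mfact[symmetric]) (auto simp: below_iff)
    moreover have "mfact (?K - ?J) = mfact (1, p - a, q - b)" using True by simp
    moreover have "unit_idx 1 + (?K - ?J) = (1, p - a, q - b)" using True by (simp add: unit_idx_def)
    ultimately show ?thesis
      using True coder_phi_w[of ?K ?J 1] assms
      by (simp only: \<phi> w_coord of_nat_mult mult_ac vector_smult_component) (simp add: \<phi> w_coord)
  next
    case False
    then show ?thesis using coder_phi_w[of ?K ?J 1] assms k w2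
      by (auto simp: \<phi> coord_def \<phi>0 unit_idx_def binomial_eq_0)
  qed
  \<comment> \<open>\<open>phi ?J 1\<close> reads the coefficient of an even monomial, and the
    component of parity r sends w_K to parity r + k. Hence only r = k is seen, which produces the
    sign (-1)^k.\<close>
  have B: "phi ?J 1 (parity_part r (coder \<phi>) (w ?K)) $ j =
     (if r = k \<and> j = 1 then of_nat (mfact ?K) * ?R else 0)" if "r \<le> 1" for r
  proof -
    have "(r + k) mod 2 = 0 \<longleftrightarrow> r = k" using k that by (cases r) auto
    then show ?thesis unfolding coeff_coder[OF assms, symmetric]
      by (auto simp: phi_def part_w[OF lin that] coeff_S_S_part axis_def)
  qed
  have "bracket \<phi> (phi ?J 1) (w ?K) $ j = of_nat (mfact ?K) *
   ((if a \<le> p \<and> b \<le> q then coord \<phi> (k + 1, p - a, q - b) j else 0) -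
    (if j = 1 then (- 1) ^ k * ?R else 0))"
    using k unfolding bracket_phi[OF assms(1) _ assms(3), simplified]
    by (auto simp: A B[of 0, simplified] B[of 1, simplified] algebra_simps
        simp del: mfact.simps)
  then show ?thesis by (simp add: coord_def del: mfact.simps)
qed

section \<open>Bases of the quotient from dual coordinates\<close>

interpretation Hs: vector_space "hscale"
  by unfold_locales (auto simp: hscale_def fun_eq_iff vec.scale_right_distrib vec.scale_left_distrib)

section \<open>The quotient as a vector space\<close>

locale cochain_subspaces =
  fixes d :: "SW \<Rightarrow> W" and n :: nat
  assumes sub_Z: "Hs.subspace (cocycles d n)"
    and sub_B: "Hs.subspace (coboundaries d n)"
begin

abbreviation cls where "cls \<equiv> coh_class d n"

lemma class_eq_iff: "cls \<phi> = cls \<psi> \<longleftrightarrow> \<phi> - \<psi> \<in> coboundaries d n"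
proof
  assume "cls \<phi> = cls \<psi>"
  moreover have "\<phi> \<in> cls \<phi>"
    using Hs.subspace_0[OF sub_B] by (force simp: coh_class_def)
  ultimately show "\<phi> - \<psi> \<in> coboundaries d n" by (auto simp: coh_class_def)
next
  assume *: "\<phi> - \<psi> \<in> coboundaries d n"
  have "\<exists>\<beta>'. \<phi> + \<beta> = \<psi> + \<beta>' \<and> \<beta>' \<in> coboundaries d n" if "\<beta> \<in> coboundaries d n" for \<beta>
    using Hs.subspace_add[OF sub_B * that] by (intro exI[of _ "\<phi> - \<psi> + \<beta>"]) simp
  moreover have "\<exists>\<beta>'. \<psi> + \<beta> = \<phi> + \<beta>' \<and> \<beta>' \<in> coboundaries d n" if "\<beta> \<in> coboundaries d n" for \<beta>
    using Hs.subspace_diff[OF sub_B that *] by (intro exI[of _ "\<beta> - (\<phi> - \<psi>)"]) simp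
  ultimately show "cls \<phi> = cls \<psi>"
    unfolding coh_class_def by blast
qed

lemma class_add: "add (H d n) (cls \<phi>) (cls \<psi>) = cls (\<phi> + \<psi>)"
proof -
  have "\<exists>\<beta> \<beta>'. \<phi> + \<psi> + \<gamma> = (\<phi> + \<beta>) + (\<psi> + \<beta>') \<and> \<beta> \<in> coboundaries d n \<and> \<beta>' \<in> coboundaries d n"
    if "\<gamma> \<in> coboundaries d n" for \<gamma>
    using that Hs.subspace_0[OF sub_B] by (intro exI[of _ \<gamma>] exI[of _ 0]) simp
  moreover have "\<exists>\<gamma>. (\<phi> + \<beta>) + (\<psi> + \<beta>') = \<phi> + \<psi> + \<gamma> \<and> \<gamma> \<in> coboundaries d n"
    if "\<beta> \<in> coboundaries d n" "\<beta>' \<in> coboundaries d n" for \<beta> \<beta>'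
    using Hs.subspace_add[OF sub_B that] by (intro exI[of _ "\<beta> + \<beta>'"]) (simp add: algebra_simps)
  ultimately show ?thesis
    unfolding H_def coh_class_def ring_record_simps by blast
qed

lemma class_smult: "smult (H d n) c (cls \<phi>) = cls (c \<cdot>\<^sub>H \<phi>)"
proof -
  \<comment> \<open>The choice \<beta> = 0, \<beta>' = \<gamma> works for every c, including c = 0,
    where the summand \<beta>' alone supplies the coboundaries.\<close>
  have "\<exists>\<beta> \<beta>'. c \<cdot>\<^sub>H \<phi> + \<gamma> = c \<cdot>\<^sub>H (\<phi> + \<beta>) + \<beta>' \<and> \<beta> \<in> coboundaries d n \<and> \<beta>' \<in> coboundaries d n"
    if "\<gamma> \<in> coboundaries d n" for \<gamma>
    using that Hs.subspace_0[OF sub_B] by (intro exI[of _ 0] exI[of _ \<gamma>]) simp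
  moreover have "\<exists>\<gamma>. c \<cdot>\<^sub>H (\<phi> + \<beta>) + \<beta>' = c \<cdot>\<^sub>H \<phi> + \<gamma> \<and> \<gamma> \<in> coboundaries d n"
    if "\<beta> \<in> coboundaries d n" "\<beta>' \<in> coboundaries d n" for \<beta> \<beta>'
    using Hs.subspace_add[OF sub_B Hs.subspace_scale[OF sub_B that(1)] that(2)]
    by (intro exI[of _ "c \<cdot>\<^sub>H \<beta> + \<beta>'"]) (simp add: Hs.scale_right_distrib add.assoc)
  ultimately show ?thesis
    unfolding H_def coh_class_def module.simps by blast
qed

lemma class_carrier: "carrier (H d n) = cls ` cocycles d n" "zero (H d n) = cls 0"
  by (simp_all add: H_def)

lemma vectorspace_H: "vectorspace class_ring (H d n)"
proof -
  note Z = Hs.subspace_0[OF sub_Z] Hs.subspace_add[OF sub_Z] Hs.subspace_scale[OF sub_Z]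
    Hs.subspace_neg[OF sub_Z]
  have "abelian_group (H d n)"
  proof (rule abelian_groupI)
    fix X assume "X \<in> carrier (H d n)"
    then obtain \<phi> where \<phi>: "\<phi> \<in> cocycles d n" "X = cls \<phi>" by (auto simp: class_carrier)
    then have "add (H d n) (cls (- \<phi>)) X = zero (H d n)" by (simp add: class_add class_carrier)
    then show "\<exists>Y\<in>carrier (H d n). add (H d n) Y X = zero (H d n)"
      using Z(4)[OF \<phi>(1)] by (auto simp: class_carrier)
  qed (auto simp: class_carrier class_add add_ac intro!: imageI Z)
  then have "Module.module class_ring (H d n)"
    by (intro moduleI) (auto simp: class_carrier class_add class_smult Hs.scale_left_distrib
        Hs.scale_right_distrib class_cring.is_cring intro!: imageI Z)
  then show ?thesis
    by (intro vectorspace.intro class_field.field_axioms)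
qed

sublocale vectorspace class_ring "H d n" by (rule vectorspace_H)

text \<open>\<open>lincomb\<close> sums over a set of classes, with coefficients depending on the
  class. Injectivity of the indexing prevents terms of the sum over J from merging.\<close>

lemma lincomb_classes:
  assumes "finite J" "inj_on (\<lambda>i. cls (z i)) J" "z ` J \<subseteq> cocycles d n"
  shows "lincomb a ((\<lambda>i. cls (z i)) ` J) = cls (\<Sum>i\<in>J. a (cls (z i)) \<cdot>\<^sub>H z i)"
  using assms
proof (induction J rule: finite_induct)
  case empty
  then show ?case by (simp add: lincomb_def class_carrier zero_fun_def)
next
  case (insert i J)
  have "lincomb a ((\<lambda>i. cls (z i)) ` J \<union> {cls (z i)}) =
      add (H d n) (smult (H d n) (a (cls (z i))) (cls (z i))) (lincomb a ((\<lambda>i. cls (z i)) ` J))"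
    using insert by (intro lincomb_insert) (auto simp: class_carrier inj_on_def)
  then show ?case
    using insert by (simp add: class_add class_smult plus_fun_def)
qed

end

section \<open>A basis criterion by dual coordinates\<close>

lemma coord_linear:
  "coord (\<phi> + \<psi>) I j = coord \<phi> I j + coord \<psi> I j"
  "coord (\<phi> - \<psi>) I j = coord \<phi> I j - coord \<psi> I j"
  "coord (c \<cdot>\<^sub>H \<phi>) I j = c * coord \<phi> I j"
  "coord 0 I j = 0"
  by (simp_all add: coord_def add_divide_distrib diff_divide_distrib hscale_def)

lemma coord_sum: "coord (\<Sum>i\<in>J. f i) I j = (\<Sum>i\<in>J. coord (f i) I j)"
  by (induction J rule: infinite_finite_induct) (simp_all only: sum.infinite sum.empty sum.insert coord_linear simp_thms)

context cochain_subspaces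
begin

text \<open>Coordinates that vanish on coboundaries are functionals on the quotient, and duality
  gives distinctness and independence. Subtracting from a cocycle the combination of the z_i
  weighted by its own coordinates leaves a coboundary, which gives spanning.\<close>

lemma cohomology_basisI:
  assumes zs: "set zs \<subseteq> cocycles d n"
    and len: "length Is = length zs"
    and dual: "\<And>i k. i < length zs \<Longrightarrow> k < length zs \<Longrightarrow>
      coord (zs ! i) (fst (Is ! k)) (snd (Is ! k)) = (if i = k then 1 else 0)"
    and vanish: "\<And>\<beta> I j. \<beta> \<in> coboundaries d n \<Longrightarrow> (I, j) \<in> set Is \<Longrightarrow> coord \<beta> I j = 0"
    and complete: "\<And>\<phi>. \<phi> \<in> cocycles d n \<Longrightarrow> (\<And>I j. (I, j) \<in> set Is \<Longrightarrow> coord \<phi> I j = 0) \<Longrightarrow>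
      \<phi> \<in> coboundaries d n"
  shows "cohomology_basis d n zs"
proof -
  let ?m = "length zs" and ?l = "\<lambda>k \<phi>. coord \<phi> (fst (Is ! k)) (snd (Is ! k))"
  let ?A = "(\<lambda>i. cls (zs ! i)) ` {..<?m}"
  have z: "zs ! i \<in> cocycles d n" if "i < ?m" for i using zs that by auto
  have l_B: "?l k \<beta> = 0" if "\<beta> \<in> coboundaries d n" "k < ?m" for k \<beta>
    using vanish[OF that(1), of "fst (Is ! k)" "snd (Is ! k)"] that(2) len by simp
  have l_sum: "?l k (\<Sum>i<?m. c i \<cdot>\<^sub>H zs ! i) = c k" if "k < ?m" for c k
  proof -
    have "?l k (\<Sum>i<?m. c i \<cdot>\<^sub>H zs ! i) = (\<Sum>i<?m. if i = k then c i else 0)"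
      unfolding coord_sum coord_linear using that by (intro sum.cong) (auto simp: dual)
    then show ?thesis using that by simp
  qed
  have inj: "inj_on (\<lambda>i. cls (zs ! i)) {..<?m}"
  proof (rule inj_onI)
    \<comment> \<open>Equal classes differ by a coboundary, on which the i-th functional is 0; for i
      \<noteq> k duality would give the value 1.\<close>
    fix i k assume ik: "i \<in> {..<?m}" "k \<in> {..<?m}" "cls (zs ! i) = cls (zs ! k)"
    then have "?l i (zs ! i - zs ! k) = 0" by (intro l_B) (auto simp: class_eq_iff)
    then show "i = k" using ik by (auto simp: coord_linear dual split: if_splits)
  qed
  have A: "set (map cls zs) = ?A" by (auto simp: set_conv_nth[of zs])
  have lc: "lincomb a ?A = cls (\<Sum>i<?m. a (cls (zs ! i)) \<cdot>\<^sub>H zs ! i)" for a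
    using inj z by (intro lincomb_classes) auto
  have sub: "?A \<subseteq> carrier (H d n)" using z by (auto simp: class_carrier)
  have "lin_indpt ?A"
  proof (rule finite_lin_indpt2)
    fix a :: "(SW \<Rightarrow> W) set \<Rightarrow> complex"
    assume "lincomb a ?A = \<zero>\<^bsub>H d n\<^esub>"
    then have "(\<Sum>i<?m. a (cls (zs ! i)) \<cdot>\<^sub>H zs ! i) \<in> coboundaries d n"
      by (simp add: lc class_carrier class_eq_iff)
    then have "a (cls (zs ! k)) = 0" if "k < ?m" for k
      using l_B[OF _ that] l_sum[OF that, of "\<lambda>i. a (cls (zs ! i))"] by simp
    then show "\<forall>v\<in>?A. a v = \<zero>\<^bsub>class_ring\<^esub>" by auto
  qed (use sub in auto)
  moreover have "span ?A = carrier (H d n)"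
  proof
    show "span ?A \<subseteq> carrier (H d n)" using sub by (rule span_is_subset2)
    show "carrier (H d n) \<subseteq> span ?A"
    proof
      fix X assume "X \<in> carrier (H d n)"
      then obtain \<phi> where \<phi>: "\<phi> \<in> cocycles d n" "X = cls \<phi>" by (auto simp: class_carrier)
      define \<sigma> where "\<sigma> = (\<Sum>i<?m. ?l i \<phi> \<cdot>\<^sub>H zs ! i)"
      have "\<sigma> \<in> cocycles d n"
        unfolding \<sigma>_def using z by (intro Hs.subspace_sum[OF sub_Z] Hs.subspace_scale[OF sub_Z]) auto
      then have "\<phi> - \<sigma> \<in> cocycles d n" by (rule Hs.subspace_diff[OF sub_Z \<phi>(1)])
      moreover have "coord (\<phi> - \<sigma>) I j = 0" if Ij: "(I, j) \<in> set Is" for I j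
      proof -
        obtain k where "k < ?m" "Is ! k = (I, j)" using Ij len by (auto simp: in_set_conv_nth)
        then show ?thesis using l_sum[of k "\<lambda>i. ?l i \<phi>"] by (simp add: coord_linear \<sigma>_def)
      qed
      ultimately have "\<phi> - \<sigma> \<in> coboundaries d n" by (rule complete)
      then have "X = cls \<sigma>" by (simp add: \<phi> class_eq_iff)
      \<comment> \<open>Coefficients must be a function of the class, so the index is recovered from
        it by \<open>inv_into\<close>.\<close>
      also have "\<dots> = lincomb (\<lambda>C. ?l (inv_into {..<?m} (\<lambda>i. cls (zs ! i)) C) \<phi>) ?A"
        unfolding lc \<sigma>_def
        by (intro arg_cong[where f = cls] sum.cong refl) (simp add: inv_into_f_f[OF inj])
      also have "\<dots> \<in> span ?A" by (subst finite_span[OF _ sub]) auto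
      finally show "X \<in> span ?A" .
    qed
  qed
  moreover have "distinct (map cls zs)"
    using inj by (auto simp: distinct_conv_nth inj_on_def)
  ultimately show ?thesis
    unfolding cohomology_basis_def A basis_def using zs sub vectorspace_H by simp
qed

end

section \<open>Cocycles and coboundaries in coordinates\<close>

lemma coord_invalid: "\<not> (fst I \<le> 1 \<and> I \<noteq> (0, 0, 0)) \<Longrightarrow> \<phi> \<in> Hom_SW \<Longrightarrow> coord \<phi> I j = 0"
proof -
  assume "\<not> (fst I \<le> 1 \<and> I \<noteq> (0, 0, 0))" and \<phi>: "\<phi> \<in> Hom_SW"
  then have "w I = 0" unfolding w_def by presburger
  moreover have "\<phi> 0 = 0" using \<phi> unfolding Hom_SW_iff by (metis S.scale_zero_left vec.scale_zero_left)
  ultimately show ?thesis by (simp add: coord_def)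
qed

lemma Hom_SW_coord_eqI:
  assumes "\<phi> \<in> Hom_SW" "\<psi> \<in> Hom_SW"
    and "\<And>k p q j. k \<le> 1 \<Longrightarrow> coord \<phi> (k, p, q) j = coord \<psi> (k, p, q) j"
  shows "\<phi> = \<psi>"
proof (rule Hom_SW_eqI[OF assms(1,2)])
  fix K :: mindex assume "fst K \<le> 1"
  then have "coord \<phi> K j = coord \<psi> K j" for j
    using assms(3) by (cases K) simp
  then show "\<phi> (w K) = \<psi> (w K)"
    by (simp add: Finite_Cartesian_Product.vec_eq_iff w_coord)
qed

lemma coord_phi:
  assumes "fst I \<le> 1" "I \<noteq> (0, 0, 0)"
  shows "coord (phi I i) K j = (if K = I \<and> j = i then 1 else 0)"
  by (auto simp: coord_def phi_w[OF assms] axis_def)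

section \<open>Degree and prescribed coordinates\<close>

lemma L_iff_coord: "\<phi> \<in> L n \<longleftrightarrow> \<phi> \<in> Hom_SW \<and> (\<forall>I j. mdeg I \<noteq> n \<longrightarrow> coord \<phi> I j = 0)"
proof (intro iffI conjI allI impI)
  assume \<phi>: "\<phi> \<in> L n"
  then show "\<phi> \<in> Hom_SW" by (simp add: L_def)
  fix I j assume I: "mdeg I \<noteq> n"
  \<comment> \<open>Inadmissible I are covered too: then w_I = 0, which lies in every
    \<open>S_deg\<close>.\<close>
  have "w I \<in> S_deg (mdeg I)"
    by (auto simp: S_deg_def w_def Abs_midx_inverse)
  then have "\<phi> (w I) = 0" using \<phi> I by (auto simp: L_def)
  then show "coord \<phi> I j = 0" by (simp add: coord_def)
next
  assume *: "\<phi> \<in> Hom_SW \<and> (\<forall>I j. mdeg I \<noteq> n \<longrightarrow> coord \<phi> I j = 0)"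
  then interpret \<phi>: Vector_Spaces.linear "(\<cdot>\<^sub>S)" "(*s)" \<phi> by (simp add: Hom_SW_def)
  have "\<phi> x = 0" if "m \<noteq> n" "x \<in> S_deg m" for m x
  proof -
    have "\<phi> (Poly_Mapping.single K 1) = 0" if "K \<in> Poly_Mapping.keys x" for K
    proof -
      have K: "mdeg (Rep_midx K) \<noteq> n" using that \<open>x \<in> S_deg m\<close> \<open>m \<noteq> n\<close> by (auto simp: S_deg_def)
      then have "\<phi> (w (Rep_midx K)) = 0"
        using * K by (simp add: Finite_Cartesian_Product.vec_eq_iff w_coord del: w_Rep split_paired_All)
      then show ?thesis by simp
    qed
    then have "\<phi> (linext (\<lambda>k. Poly_Mapping.single k 1) x) = 0"
      by (simp add: linext_def \<phi>.sum \<phi>.scale)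
    then show ?thesis by (simp only: single_expansion[symmetric])
  qed
  with * show "\<phi> \<in> L n" by (simp add: L_def)
qed

lemma phi_in_L:
  assumes "fst I \<le> 1" "I \<noteq> (0, 0, 0)"
  shows "phi I j \<in> L (mdeg I)"
  unfolding L_iff_coord using phi_Hom by (auto simp: coord_phi[OF assms] simp del: split_paired_All)

text \<open>Supplies primitives for the coboundary proofs. The map is the corestriction of the
  coderivation built from the array; the factor I! undoes the division in
  \<open>coord\<close>.\<close>

lemma ex_coord:
  assumes "\<And>I j. mdeg I \<noteq> n \<Longrightarrow> g I j = 0" "\<And>I j. \<not> (fst I \<le> 1 \<and> I \<noteq> (0, 0, 0)) \<Longrightarrow> g I j = 0"
  shows "\<exists>\<phi>\<in>L n. coord \<phi> = g"
proof -
  let ?a = "\<lambda>I j. of_nat (mfact I) * g I j"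
  let ?\<phi> = "corestrict (extend_coder ?a)"
  have "?a I j = 0" if "w I = 0" for I j
  proof -
    have "\<not> (fst I \<le> 1 \<and> I \<noteq> (0, 0, 0))"
      using that coeff_S_w[of I I] by (metis coeff_S_zero zero_neq_one)
    then show ?thesis by (simp add: assms(2))
  qed
  then have *: "?\<phi> (w K) $ j = ?a K j" if "fst K \<le> 1" for K j
    using that by (rule corestrict_extend_coder)
  have Hom: "?\<phi> \<in> Hom_SW"
    by (rule linear_corestrict[OF linear_extend_coder])
  have "coord ?\<phi> K j = g K j" for K j
  proof (cases "fst K \<le> 1")
    case True
    then show ?thesis by (simp add: coord_def *)
  next
    case False
    then show ?thesis using assms(2)[of K j] coord_invalid[of K ?\<phi> j, OF _ Hom] by simp
  qed
  then have "coord ?\<phi> = g" by (intro ext)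
  then show ?thesis using Hom assms(1) by (intro bexI[of _ ?\<phi>]) (auto simp: L_iff_coord)
qed

lemma Hom_SW_closed:
  "0 \<in> Hom_SW" "\<phi> \<in> Hom_SW \<Longrightarrow> c \<cdot>\<^sub>H \<phi> \<in> Hom_SW"
  "\<phi> \<in> Hom_SW \<Longrightarrow> \<psi> \<in> Hom_SW \<Longrightarrow> \<phi> + \<psi> \<in> Hom_SW"
  unfolding Hom_SW_iff by (simp_all add: hscale_def algebra_simps)

lemma subspace_L: "Hs.subspace (L n)"
  unfolding Hs.subspace_def
  by (auto simp: L_iff_coord coord_linear Hom_SW_closed simp del: split_paired_All)

lemma L_Hom: "\<phi> \<in> L n \<Longrightarrow> \<phi> \<in> Hom_SW"
  by (simp add: L_def)

section \<open>Linearity of D and coordinatewise tests for cocycles and coboundaries\<close>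

context
  fixes a b :: nat and d
  assumes ab: "(0::nat, a, b) \<noteq> (0, 0, 0)"
  defines "d \<equiv> phi (0, a, b) 1"
begin

lemma bracket_Hom: "\<phi> \<in> Hom_SW \<Longrightarrow> bracket \<phi> d \<in> Hom_SW"
  unfolding d_def by (rule bracket_phi_Hom) (use ab in auto)

lemma bracket_add:
  assumes "\<phi> \<in> Hom_SW" "\<psi> \<in> Hom_SW"
  shows "bracket (\<phi> + \<psi>) d = bracket \<phi> d + bracket \<psi> d"
  using assms by (intro Hom_SW_coord_eqI Hom_SW_closed bracket_Hom)
    (simp_all add: d_def coord_bracket[OF _ _ ab] Hom_SW_closed coord_linear algebra_simps)

lemma bracket_scale:
  assumes "\<phi> \<in> Hom_SW"
  shows "bracket (c \<cdot>\<^sub>H \<phi>) d = c \<cdot>\<^sub>H bracket \<phi> d"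
  using assms by (intro Hom_SW_coord_eqI Hom_SW_closed bracket_Hom)
    (simp_all add: d_def coord_bracket[OF _ _ ab] Hom_SW_closed coord_linear algebra_simps)

lemma cochain_subspaces_phi: "cochain_subspaces d n"
proof
  note L = Hs.subspace_0[OF subspace_L] Hs.subspace_add[OF subspace_L] Hs.subspace_scale[OF subspace_L]
  have 0: "bracket 0 d = 0"
    using bracket_scale[OF Hom_SW_closed(1), of 0] by simp
  show "Hs.subspace (cocycles d n)"
    using L by (auto simp: Hs.subspace_def cocycles_def 0 bracket_add bracket_scale L_Hom simp del: zero_fun_apply)
  show "Hs.subspace (coboundaries d n)"
    unfolding Hs.subspace_def coboundaries_def
    using L 0 by (auto simp: bracket_add[symmetric] bracket_scale[symmetric] L_Hom intro!: imageI)
qed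

lemma cocycle_iff:
  "\<phi> \<in> cocycles d n \<longleftrightarrow> \<phi> \<in> L n \<and> (\<forall>k p q j. k \<le> 1 \<longrightarrow> coord (bracket \<phi> d) (k, p, q) j = 0)"
proof (intro iffI conjI)
  assume "\<phi> \<in> cocycles d n"
  then show "\<phi> \<in> L n" "\<forall>k p q j. k \<le> 1 \<longrightarrow> coord (bracket \<phi> d) (k, p, q) j = 0"
    by (auto simp: cocycles_def coord_linear)
next
  assume *: "\<phi> \<in> L n \<and> (\<forall>k p q j. k \<le> 1 \<longrightarrow> coord (bracket \<phi> d) (k, p, q) j = 0)"
  have "bracket \<phi> d = 0"
    using * by (intro Hom_SW_coord_eqI bracket_Hom L_Hom[OF Hs.subspace_0[OF subspace_L]])
      (auto simp: coord_linear L_Hom)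
  with * show "\<phi> \<in> cocycles d n" by (simp add: cocycles_def)
qed

lemma coboundaryI:
  assumes "\<phi> \<in> Hom_SW" "\<psi> \<in> L (n - 1)"
    and "\<And>k p q j. k \<le> 1 \<Longrightarrow> coord (bracket \<psi> d) (k, p, q) j = coord \<phi> (k, p, q) j"
  shows "\<phi> \<in> coboundaries d n"
proof -
  have "bracket \<psi> d = \<phi>"
    using assms by (intro Hom_SW_coord_eqI bracket_Hom) (auto simp: L_Hom)
  then show ?thesis using assms(2) by (auto simp: coboundaries_def)
qed

end

section \<open>The two codifferentials\<close>

text \<open>Boundary conventions: S(W) has no degree 0, and w_1^2 = 0. The second makes the shifted
  term with k + 1 disappear for k = 1.\<close>

lemma coord_zero: "\<phi> \<in> Hom_SW \<Longrightarrow> coord \<phi> (0, 0, 0) j = 0"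
  "\<phi> \<in> Hom_SW \<Longrightarrow> coord \<phi> (Suc (Suc k), I) j = 0"
  by (auto intro: coord_invalid)

lemma coord_bracket_011:
  assumes "\<phi> \<in> Hom_SW" "k \<le> 1"
  shows "coord (bracket \<phi> (phi (0, 1, 1) 1)) (k, p, q) j =
    (if 0 < p \<and> 0 < q then coord \<phi> (Suc k, p - 1, q - 1) j else 0) -
    (if j = 1 then (- 1) ^ k * ((if 0 < q then coord \<phi> (k, p, q - 1) 2 else 0) +
      (if 0 < p then coord \<phi> (k, p - 1, q) 3 else 0)) else 0)"
  by (subst coord_bracket[OF assms]) (simp_all add: Suc_le_eq)

lemma coord_bracket_020:
  assumes "\<phi> \<in> Hom_SW" "k \<le> 1"
  shows "coord (bracket \<phi> (phi (0, 2, 0) 1)) (k, p, q) j =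
    (if 2 \<le> p then coord \<phi> (Suc k, p - 2, q) j else 0) -
    (if j = 1 then (- 1) ^ k * (if 0 < p then 2 * coord \<phi> (k, p - 1, q) 2 else 0) else 0)"
  by (subst coord_bracket[OF assms]) (simp_all add: Suc_le_eq)

text \<open>For a cocycle, B_2 = B_3 = 0, B_1 is determined by A_2 and A_3, A_2 has no pure powers
  of \<partial>_3 and A_3 none of \<partial>_2. The vanishing assumptions remove the other pure
  powers, so Q divides A_2 and A_3 and a primitive can be written down.\<close>

lemma coboundary_011:
  assumes "1 \<le> n" and \<phi>: "\<phi> \<in> cocycles (phi (0, 1, 1) 1) n"
    and z: "coord \<phi> (0, 1, 0) 1 = 0" "coord \<phi> (0, 0, 1) 1 = 0"
      "coord \<phi> (0, n, 0) 2 = 0" "coord \<phi> (0, 0, n) 3 = 0"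
  shows "\<phi> \<in> coboundaries (phi (0, 1, 1) 1) n"
proof -
  have ne: "(0::nat, 1::nat, 1::nat) \<noteq> (0, 0, 0)" by simp
  have L: "\<phi> \<in> L n" and Hom: "\<phi> \<in> Hom_SW" using \<phi> by (auto simp: cocycles_def L_Hom)
  let ?f = "coord \<phi>"
  have deg: "?f I j = 0" if "mdeg I \<noteq> n" for I j using L that by (simp add: L_iff_coord del: split_paired_All)
  have "coord (bracket \<phi> (phi (0, 1, 1) 1)) (0, p, q) j = 0" for p q j
    using \<phi> unfolding cocycle_iff[OF ne] by blast
  note E = this[unfolded coord_bracket_011[OF Hom le0]]
  \<comment> \<open>Evaluating at exponents raised by one undoes the multiplication by Q.\<close>
  have e1: "?f (Suc 0, p, q) j = 0" if "j \<noteq> 1" for p q j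
    using E[of "Suc p" "Suc q" j] that by simp
  have e2: "?f (Suc 0, p, q) 1 = ?f (0, Suc p, q) 2 + ?f (0, p, Suc q) 3" for p q
    using E[of "Suc p" "Suc q" 1] by simp
  \<comment> \<open>At q = 0 the terms B_1 Q and Q_2 A_2 drop out as multiples of \<partial>_3,
    leaving A_3 alone; p = 0 isolates A_2 in the same way.\<close>
  have e3: "?f (0, p, 0) 3 = 0" for p
    using E[of "Suc p" 0 1] by simp
  have e4: "?f (0, 0, q) 2 = 0" for q
    using E[of 0 "Suc q" 1] by simp
  have e5: "?f (0, 0, q) 3 = 0" for q using z(4) deg[of "(0, 0, q)"] by (cases "q = n") auto
  have e6: "?f (0, p, 0) 2 = 0" for p using z(3) deg[of "(0, p, 0)"] by (cases "p = n") auto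
  \<comment> \<open>The primitive has B_1 = 0 and B_j = A_j / Q for j = 2, 3. Its A_3 produces the
    terms of A_1 divisible by \<partial>_2, its A_2 the pure powers of \<partial>_3.\<close>
  define g where "g = (\<lambda>(k :: nat, p, q) j.
     if k = 1 \<and> j \<noteq> 1 then ?f (0, Suc p, Suc q) j
     else if k = 0 \<and> j = 3 then - ?f (0, Suc p, q) 1
     else if k = 0 \<and> j = 2 \<and> p = 0 then - ?f (0, 0, Suc q) 1 else 0)"
  have "\<exists>\<psi>\<in>L (n - 1). coord \<psi> = g"
  proof (rule ex_coord)
    show "g I j = 0" if "mdeg I \<noteq> n - 1" for I j
      using that assms(1) by (cases I) (auto simp: g_def intro!: deg)
    \<comment> \<open>At (0,0,0) the array holds the two linear coefficients of A_1, which vanish by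
      assumption.\<close>
    show "g I j = 0" if "\<not> (fst I \<le> 1 \<and> I \<noteq> (0, 0, 0))" for I j
      using that z by (cases I) (auto simp: g_def)
  qed
  then obtain \<psi> where \<psi>: "\<psi> \<in> L (n - 1)" "coord \<psi> = g" by blast
  show ?thesis
  proof (rule coboundaryI[OF ne Hom \<psi>(1)])
    fix k p q :: nat and j :: 3 assume k: "k \<le> 1"
    note c' = coord_bracket_011[OF L_Hom[OF \<psi>(1)] k, unfolded \<psi>(2)]
    have "k = 0 \<or> k = 1" "p = 0 \<or> (\<exists>r. p = Suc r)" "q = 0 \<or> (\<exists>r. q = Suc r)"
      using k not0_implies_Suc[of p] not0_implies_Suc[of q] by auto
    then show "coord (bracket \<psi> (phi (0, 1, 1) 1)) (k, p, q) j = ?f (k, p, q) j"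
      unfolding c' using exhaust_3[of j]
      by (elim disjE exE) (simp_all add: g_def e1 e2 e3 e4 e5 e6 coord_zero[OF Hom])
  qed
qed

text \<open>Here a cocycle satisfies B_2 = B_3 = 0 and 2 A_2 = \<partial>_2 B_1. The vanishing
  assumptions make A_2 and A_3 divisible by \<partial>_2^2 and A_1 divisible by
  \<partial>_2.\<close>

lemma coboundary_020:
  assumes "1 \<le> n" and \<phi>: "\<phi> \<in> cocycles (phi (0, 2, 0) 1) n"
    and z: "coord \<phi> (0, 1, 0) 1 = 0" "coord \<phi> (0, 0, n) 1 = 0"
      "coord \<phi> (0, 0, n) 3 = 0" "coord \<phi> (0, 1, n - 1) 3 = 0" "coord \<phi> (0, 1, n - 1) 2 = 0"
  shows "\<phi> \<in> coboundaries (phi (0, 2, 0) 1) n"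
proof -
  have ne: "(0::nat, 2::nat, 0::nat) \<noteq> (0, 0, 0)" by simp
  have L: "\<phi> \<in> L n" and Hom: "\<phi> \<in> Hom_SW" using \<phi> by (auto simp: cocycles_def L_Hom)
  let ?f = "coord \<phi>"
  have deg: "?f I j = 0" if "mdeg I \<noteq> n" for I j using L that by (simp add: L_iff_coord del: split_paired_All)
  have "coord (bracket \<phi> (phi (0, 2, 0) 1)) (0, p, q) j = 0" for p q j
    using \<phi> unfolding cocycle_iff[OF ne] by blast
  note E = this[unfolded coord_bracket_020[OF Hom le0]]
  have e1: "?f (Suc 0, p, q) j = 0" if "j \<noteq> 1" for p q j
    using E[of "p + 2" q j] that by simp
  have e2: "?f (Suc 0, p, q) 1 = 2 * ?f (0, Suc p, q) 2" for p q
    using E[of "p + 2" q 1] by simp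
  have e3: "?f (0, 0, q) 2 = 0" for q
    using E[of 1 q 1] by simp
  have e4: "?f (0, 0, q) 1 = 0" "?f (0, 0, q) 3 = 0" for q
    using z(2,3) deg[of "(0, 0, q)"] by (cases "q = n"; auto)+
  have e5: "?f (0, Suc 0, q) 2 = 0" "?f (0, Suc 0, q) 3 = 0" for q
    using z(4,5) deg[of "(0, 1, q)"] by (cases "q = n - 1"; auto)+
  \<comment> \<open>Again B_2 and B_3 are quotients by Q. The A_1 part is produced by A_2 alone,
    with the factor 1/2 because Q_2 = 2 \<partial>_2.\<close>
  define g where "g = (\<lambda>(k :: nat, p, q) j.
     if k = 1 \<and> j \<noteq> 1 then ?f (0, p + 2, q) j
     else if k = 0 \<and> j = 2 then - ?f (0, Suc p, q) 1 / 2 else 0)"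
  have "\<exists>\<psi>\<in>L (n - 1). coord \<psi> = g"
  proof (rule ex_coord)
    show "g I j = 0" if "mdeg I \<noteq> n - 1" for I j
      using that assms(1) by (cases I) (auto simp: g_def intro!: deg)
    show "g I j = 0" if "\<not> (fst I \<le> 1 \<and> I \<noteq> (0, 0, 0))" for I j
      using that z by (cases I) (auto simp: g_def)
  qed
  then obtain \<psi> where \<psi>: "\<psi> \<in> L (n - 1)" "coord \<psi> = g" by blast
  show ?thesis
  proof (rule coboundaryI[OF ne Hom \<psi>(1)])
    fix k p q :: nat and j :: 3 assume k: "k \<le> 1"
    note c' = coord_bracket_020[OF L_Hom[OF \<psi>(1)] k, unfolded \<psi>(2)]
    have "k = 0 \<or> k = 1" using k by auto
    moreover have "p = 0 \<or> p = 1 \<or> (\<exists>r. p = Suc (Suc r))"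
      by (metis One_nat_def not0_implies_Suc)
    ultimately show "coord (bracket \<psi> (phi (0, 2, 0) 1)) (k, p, q) j = ?f (k, p, q) j"
      unfolding c' using exhaust_3[of j]
      by (elim disjE exE) (simp_all add: g_def e1 e2 e3 e4 e5 coord_zero[OF Hom])
  qed
qed

section \<open>Codifferentials, vanishing on coboundaries, and the listed cocycles\<close>

lemma codifferential_phi:
  assumes "a + b = 2"
  shows "codifferential (phi (0, a, b) 1)"
proof -
  have ne: "(0::nat, a, b) \<noteq> (0, 0, 0)" using assms by auto
  have "has_parity 1 (phi (0, a, b) 1)"
    unfolding has_parity_def
  proof (intro allI impI)
    fix K j assume "phi (0, a, b) 1 (Poly_Mapping.single K 1) $ j \<noteq> 0"
    then have "Rep_midx K = (0, a, b)" "j = 1"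
      using phi_w[OF _ ne, of 1 "Rep_midx K"] by (auto simp: axis_def split: if_splits)
    then show "par_W j = (1 + par K) mod 2" by (simp add: par_W_def par_def)
  qed
  moreover have "phi (0, a, b) 1 \<in> L 2" using phi_in_L[OF _ ne, of 1] assms by simp
  \<comment> \<open>[d,d] = 0 is the cocycle condition for d itself: d has only an A_1 part, which
    does not enter D.\<close>
  moreover have "phi (0, a, b) 1 \<in> cocycles (phi (0, a, b) 1) 2"
    unfolding cocycle_iff[OF ne] using calculation(2)
    by (simp add: coord_bracket[OF phi_Hom _ ne] coord_phi[OF _ ne])
  ultimately show ?thesis by (simp add: codifferential_def cocycles_def)
qed

text \<open>The term B_j Q reaches only exponents with p at least a and q at least b, which are
  excluded. The derivative terms occur only for j = 1; then p + q = 1 and a + b = 2 make them read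
  A_2 and A_3 in degree 0, where they vanish.\<close>

lemma vanish_coboundaries:
  assumes "(0::nat, a, b) \<noteq> (0, 0, 0)" "\<beta> \<in> coboundaries (phi (0, a, b) 1) n"
   and "a \<le> p \<Longrightarrow> b \<le> q \<Longrightarrow> False"
   and "j = 1 \<Longrightarrow> p + q = 1"
   and "a + b = 2"
  shows "coord \<beta> (0, p, q) j = 0"
proof -
  obtain \<psi> where \<psi>: "\<beta> = bracket \<psi> (phi (0, a, b) 1)" "\<psi> \<in> Hom_SW"
    using assms(2) by (auto simp: coboundaries_def L_Hom)
  have "a - 1 \<le> p \<Longrightarrow> b \<le> q \<Longrightarrow> 0 < a \<Longrightarrow> j = 1 \<Longrightarrow> (p - (a - 1), q - b) = (0, 0)"
    "a \<le> p \<Longrightarrow> b - 1 \<le> q \<Longrightarrow> 0 < b \<Longrightarrow> j = 1 \<Longrightarrow> (p - a, q - (b - 1)) = (0, 0)"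
    using assms(4,5) by auto
  then show ?thesis
    unfolding \<psi>(1) using assms(3) \<psi>(2)
    by (auto simp: coord_bracket[OF \<psi>(2) _ assms(1)] coord_zero)
qed

lemma phi_1_cocycle:
  assumes "(0::nat, a, b) \<noteq> (0, 0, 0)" "(0::nat, p, q) \<noteq> (0, 0, 0)"
  shows "phi (0, p, q) 1 \<in> cocycles (phi (0, a, b) 1) (p + q)"
  unfolding cocycle_iff[OF assms(1)] using phi_in_L[OF _ assms(2), of 1]
  by (simp add: coord_bracket[OF phi_Hom _ assms(1)] coord_phi[OF _ assms(2)])

text \<open>With B_1 = \<partial>_3^(n-1) and A_3 = \<partial>_3^n, both B_1 Q and Q_3 A_3 equal
  \<partial>_2 \<partial>_3^n and cancel. The second cocycle exchanges the roles of \<partial>_2 and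
  \<partial>_3.\<close>

lemma cocycles_011:
  assumes "1 \<le> n"
  shows "phi (1, 0, n - 1) 1 + phi (0, 0, n) 3 \<in> cocycles (phi (0, 1, 1) 1) n" (is ?A)
    and "phi (1, n - 1, 0) 1 + phi (0, n, 0) 2 \<in> cocycles (phi (0, 1, 1) 1) n" (is ?B)
proof -
  have ne: "(0::nat, 1::nat, 1::nat) \<noteq> (0, 0, 0)" by simp
  have L: "phi (1, 0, n - 1) 1 + phi (0, 0, n) 3 \<in> L n" "phi (1, n - 1, 0) 1 + phi (0, n, 0) 2 \<in> L n"
    using phi_in_L[of "(1, 0, n - 1)" 1] phi_in_L[of "(0, 0, n)" 3]
      phi_in_L[of "(1, n - 1, 0)" 1] phi_in_L[of "(0, n, 0)" 2] assms
    by (auto intro!: Hs.subspace_add[OF subspace_L])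
  show ?A unfolding cocycle_iff[OF ne]
  proof (intro conjI allI impI L(1))
    fix k p q :: nat and j :: 3 assume k: "k \<le> 1"
    show "coord (bracket (phi (1, 0, n - 1) 1 + phi (0, 0, n) 3) (phi (0, 1, 1) 1)) (k, p, q) j = 0"
      unfolding coord_bracket_011[OF L_Hom[OF L(1)] k] coord_linear using assms
      by (auto simp: coord_phi)
  qed
  show ?B unfolding cocycle_iff[OF ne]
  proof (intro conjI allI impI L(2))
    fix k p q :: nat and j :: 3 assume k: "k \<le> 1"
    show "coord (bracket (phi (1, n - 1, 0) 1 + phi (0, n, 0) 2) (phi (0, 1, 1) 1)) (k, p, q) j = 0"
      unfolding coord_bracket_011[OF L_Hom[OF L(2)] k] coord_linear using assms
      by (auto simp: coord_phi)
  qed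
qed

text \<open>The coefficient 2 matches Q_2 = 2 \<partial>_2, so B_1 Q = Q_2 A_2. Since Q_3 = 0, an
  A_3 part alone is always closed.\<close>

lemma cocycles_020:
  assumes "1 \<le> n"
  shows "2 \<cdot>\<^sub>H phi (1, 0, n - 1) 1 + phi (0, 1, n - 1) 2 \<in> cocycles (phi (0, 2, 0) 1) n" (is ?A)
    and "a + b = n \<Longrightarrow> phi (0, a, b) 3 \<in> cocycles (phi (0, 2, 0) 1) n" (is "_ \<Longrightarrow> ?B")
proof -
  have ne: "(0::nat, 2::nat, 0::nat) \<noteq> (0, 0, 0)" by simp
  have L: "2 \<cdot>\<^sub>H phi (1, 0, n - 1) 1 + phi (0, 1, n - 1) 2 \<in> L n"
    using phi_in_L[of "(1, 0, n - 1)" 1] phi_in_L[of "(0, 1, n - 1)" 2] assms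
    by (auto intro!: Hs.subspace_add[OF subspace_L] Hs.subspace_scale[OF subspace_L])
  show ?A unfolding cocycle_iff[OF ne]
  proof (intro conjI allI impI L)
    fix k p q :: nat and j :: 3 assume k: "k \<le> 1"
    show "coord (bracket (2 \<cdot>\<^sub>H phi (1, 0, n - 1) 1 + phi (0, 1, n - 1) 2) (phi (0, 2, 0) 1))
        (k, p, q) j = 0"
      unfolding coord_bracket_020[OF L_Hom[OF L] k] coord_linear using assms
      by (auto simp: coord_phi)
  qed
  assume "a + b = n"
  then have ab: "(0, a, b) \<noteq> (0, 0, 0)" "mdeg (0, a, b) = n" using assms by auto
  show ?B unfolding cocycle_iff[OF ne]
  proof (intro conjI allI impI)
    show "phi (0, a, b) 3 \<in> L n" using phi_in_L[OF _ ab(1), of 3] ab(2) by simp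
    fix k p q :: nat and j :: 3 assume k: "k \<le> 1"
    show "coord (bracket (phi (0, a, b) 3) (phi (0, 2, 0) 1)) (k, p, q) j = 0"
      unfolding coord_bracket_020[OF phi_Hom k] by (simp add: coord_phi[OF _ ab(1)])
  qed
qed

section \<open>The four bases\<close>

text \<open>Since L_0 = 0, neither linear term of A_1 is a coboundary, hence two extra classes. The
  last two cocycles share a summand, so their dual coordinates are taken from the other
  summands.\<close>

lemma cohomology_011_1:
  "cohomology_basis (psi (0, 1, 1) 1) 1
       [psi (0, 0, 1) 1, psi (0, 1, 0) 1,
        phi (1, 0, 0) 1 + phi (0, 0, 1) 3, phi (1, 0, 0) 1 + phi (0, 1, 0) 2]"
proof (rule cochain_subspaces.cohomology_basisI[OF cochain_subspaces_phi,
    where Is = "[((0, 0, 1), 1), ((0, 1, 0), 1), ((0, 0, 1), 3), ((0, 1, 0), 2)]"], goal_cases)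
  case 2
  then show ?case
    using phi_1_cocycle[of 1 1 0 1] phi_1_cocycle[of 1 1 1 0] cocycles_011[of 1] by simp
next
  case (4 i k)
  then show ?case
    by (auto simp: less_Suc_eq numeral_eq_Suc coord_linear coord_phi)
next
  case (5 \<beta> I j)
  then show ?case by (auto intro!: vanish_coboundaries[OF _ 5(1)])
next
  case (6 \<phi>)
  then show ?case by (intro coboundary_011) auto
qed auto

lemma cohomology_011:
  assumes "1 < n"
  shows "cohomology_basis (psi (0, 1, 1) 1) n
       [phi (1, 0, n - 1) 1 + phi (0, 0, n) 3,
        phi (1, n - 1, 0) 1 + phi (0, n, 0) 2]"
proof (rule cochain_subspaces.cohomology_basisI[OF cochain_subspaces_phi,
    where Is = "[((0, 0, n), 3), ((0, n, 0), 2)]"], goal_cases)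
  case 2
  then show ?case using cocycles_011[of n] assms by simp
next
  case (4 i k)
  then show ?case
    using assms by (auto simp: less_Suc_eq numeral_eq_Suc coord_linear coord_phi)
next
  case (5 \<beta> I j)
  then show ?case using assms by (auto intro!: vanish_coboundaries[OF _ 5(1)])
next
  case (6 \<phi>)
  \<comment> \<open>For n > 1 the linear coefficients of A_1 required by
    \<open>coboundary_011\<close> vanish because \<phi> has degree n.\<close>
  then have "coord \<phi> I j = 0" if "mdeg I \<noteq> n" for I j
    using that by (auto simp: cocycles_def L_iff_coord simp del: split_paired_All)
  then show ?case using 6 assms by (intro coboundary_011) auto
qed auto

lemma cohomology_020_1:
  "cohomology_basis (psi (0, 2, 0) 1) 1
       [psi (0, 0, 1) 1, psi (0, 1, 0) 1, phi (0, 0, 1) 3, phi (0, 1, 0) 3,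
        2 \<cdot>\<^sub>H phi (1, 0, 0) 1 + phi (0, 1, 0) 2]"
proof (rule cochain_subspaces.cohomology_basisI[OF cochain_subspaces_phi,
    where Is = "[((0, 0, 1), 1), ((0, 1, 0), 1), ((0, 0, 1), 3), ((0, 1, 0), 3), ((0, 1, 0), 2)]"],
    goal_cases)
  case 2
  then show ?case
    using phi_1_cocycle[of 2 0 0 1] phi_1_cocycle[of 2 0 1 0] cocycles_020[of 1] by simp
next
  case (4 i k)
  then show ?case
    by (auto simp: less_Suc_eq numeral_eq_Suc coord_linear coord_phi)
next
  case (5 \<beta> I j)
  then show ?case by (auto intro!: vanish_coboundaries[OF _ 5(1)])
next
  case (6 \<phi>)
  then show ?case by (intro coboundary_020) auto
qed auto

text \<open>Unlike for Q = \<partial>_2 \<partial>_3, the power \<partial>_3^n in A_1 survives in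
  every degree, since D only produces multiples of \<partial>_2 there.\<close>

lemma cohomology_020:
  assumes "1 < n"
  shows "cohomology_basis (psi (0, 2, 0) 1) n
       [psi (0, 0, n) 1, phi (0, 0, n) 3, phi (0, 1, n - 1) 3,
        2 \<cdot>\<^sub>H phi (1, 0, n - 1) 1 + phi (0, 1, n - 1) 2]"
proof (rule cochain_subspaces.cohomology_basisI[OF cochain_subspaces_phi,
    where Is = "[((0, 0, n), 1), ((0, 0, n), 3), ((0, 1, n - 1), 3), ((0, 1, n - 1), 2)]"],
    goal_cases)
  case 2
  then show ?case
    using phi_1_cocycle[of 2 0 0 n] cocycles_020[of n] assms by simp
next
  case (4 i k)
  then show ?case
    using assms by (auto simp: less_Suc_eq numeral_eq_Suc coord_linear coord_phi)
next
  case (5 \<beta> I j)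
  \<comment> \<open>\<open>vanish_coboundaries\<close> treats j = 1 only in degree 1, so the
    coordinates are computed directly: for j = 1 every term needs p > 0, for j = 2, 3 it needs p at
    least 2.\<close>
  obtain \<psi> where "\<beta> = bracket \<psi> (phi (0, 2, 0) 1)" "\<psi> \<in> Hom_SW"
    using 5(1) by (auto simp: coboundaries_def L_Hom)
  then show ?case using 5(2) by (auto simp: coord_bracket)
next
  case (6 \<phi>)
  then have "coord \<phi> I j = 0" if "mdeg I \<noteq> n" for I j
    using that by (auto simp: cocycles_def L_iff_coord simp del: split_paired_All)
  then show ?case using 6 assms by (intro coboundary_020) auto
qed auto

theorem mainTheorem7:
  shows
    "codifferential (psi (0, 1, 1) 1) \<and>
     cohomology_basis (psi (0, 1, 1) 1) 1
       [psi (0, 0, 1) 1, psi (0, 1, 0) 1,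
        phi (1, 0, 0) 1 + phi (0, 0, 1) 3, phi (1, 0, 0) 1 + phi (0, 1, 0) 2] \<and>
     (\<forall>n > 1. cohomology_basis (psi (0, 1, 1) 1) n
       [phi (1, 0, n - 1) 1 + phi (0, 0, n) 3,
        phi (1, n - 1, 0) 1 + phi (0, n, 0) 2]) \<and>
     codifferential (psi (0, 2, 0) 1) \<and>
     cohomology_basis (psi (0, 2, 0) 1) 1
       [psi (0, 0, 1) 1, psi (0, 1, 0) 1, phi (0, 0, 1) 3, phi (0, 1, 0) 3,
        2 \<cdot>\<^sub>H phi (1, 0, 0) 1 + phi (0, 1, 0) 2] \<and>
     (\<forall>n > 1. cohomology_basis (psi (0, 2, 0) 1) n
       [psi (0, 0, n) 1, phi (0, 0, n) 3, phi (0, 1, n - 1) 3,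
        2 \<cdot>\<^sub>H phi (1, 0, n - 1) 1 + phi (0, 1, n - 1) 2])"
  using codifferential_phi[of 1 1] codifferential_phi[of 2 0] cohomology_011_1 cohomology_020_1
    cohomology_011 cohomology_020
  by simp

end
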